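(* Let $S=\{(x_1,y_1),\dots,(x_m,y_m)\}$ with $y_i\in\{1,\dots,d_y\}$, let $\alpha\in(0,1)$ (with $\alpha m$ an integer), let $S_{\alpha m}=\{(x_1,y_1),\dots,(x_{\alpha m},y_{\alpha m})\}$ and $m_\sigma=(1-\alpha)m$. Assume that $S\setminus S_{\alpha m}$ is generated by i.i.d. draws according to a distribution $\mathbb{P}_{(X,Y)}$ and is independent of $S_{\alpha m}$. Fix $\rho>0$ and $w_\sigma$. Let $\mathcal{F}$ be the set of the models of the two-phase training procedure with frozen parameter $w_\sigma$ (defined in the context). Suppose that $\mathbb{E}_x[\|\bar x\circ\bar\sigma(x,w_\sigma)\|_2^2]\le C_\sigma^2$ and $\max_k\|\bar w_k\|_2\le C_w$ for all $f\in\mathcal{F}$. Then, for any $\delta>0$, with probability at least $1-\delta$, the following holds for all $f\in\mathcal{F}$: $$\mathcal{R}[f]\le\mathcal{R}^{(\rho)}_{S\setminus S_{\alpha m}}[f]+\frac{2d_y^2(1-\alpha)^{-1/2}C_\sigma C_w}{\rho\sqrt{m_\sigma}}+\sqrt{\frac{\ln\frac1\delta}{2m_\sigma}}.$$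
   Context: Network. The network has layers $0,1,\dots,L$ of widths $n_0,\dots,n_L$ with $n_L=d_y\ge2$ (the number of classes); inputs are $x\in\mathbb{R}^{n_0}$. Its pre-activations are $z^{[l]}(x,w)=\sum_{l'=0}^{l-1}W^{(l,l')}\sigma^{[l']}(z^{[l']}(x,w))$ for $l=1,\dots,L$, with $\sigma^{[0]}(z^{[0]}(x,w))\equiv x$. The weight matrices $W^{(l,l')}\in\mathbb{R}^{n_l\times n_{l'}}$ (of any structure) are determined by the trainable parameter vector $w$. The nonlinearities $\sigma^{[l]}$ (ReLU and/or max pooling) satisfy $\sigma^{[l]}(z^{[l]}(x,w))=\dot\sigma^{[l]}(x,w)\circ z^{[l]}(x,w)$ with $\dot\sigma^{[l]}(x,w)\in\{0,1\}^{n_l}$, where $\circ$ is the entrywise product. Paths. A path index $j$ is a choice of layers $0=l_0<l_1<\dots<l_h<L$ ($h\ge0$) and of a unit $i_s\in\{1,\dots,n_{l_s}\}$ in each. Define $\bar x_j=x_{i_0}$, $\bar\sigma_j(x,w)=\prod_{s=1}^h\dot\sigma^{[l_s]}_{i_s}(x,w)\in\{0,1\}$ and $\bar w_{k,j}=W^{(L,l_h)}_{ki_h}\prod_{s=1}^hW^{(l_s,l_{s-1})}_{i_si_{s-1}}$; $\bar x,\bar\sigma(x,w),\bar w_k$ are the vectors of these entries over all paths. Then $z_k^{[L]}(x,w)=[\bar x\circ\bar\sigma(x,w)]^\top\bar w_k$. Two-phase training procedure. First the network is trained using only $S_{\alpha m}$, giving $w_\sigma:=w^{S_{\alpha m}}$,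 which is then frozen. Then only the path weights $\bar w_k$ are trained further, using all of $S$, with $\bar\sigma(x,w_\sigma)$ kept frozen. The resulting models have outputs $z_k^{[L]}(x)=[\bar x\circ\bar\sigma(x,w_\sigma)]^\top\bar w_k$, $k=1,\dots,d_y$. $\mathcal{F}$ is the set of all such models for the fixed $w_\sigma$, as $(\bar w_k)_{k=1}^{d_y}$ ranges over the set of allowed path weights; it does not depend on $S\setminus S_{\alpha m}$. The probability is over the draw of $S\setminus S_{\alpha m}$. Risks. For a model $f$ with outputs $z^{[L]}_k$, the predicted label is $\operatorname{argmax}_{k\in\{1,\dots,d_y\}}z_k^{[L]}(x)$, and $\mathcal{R}[f]$ is the expected 0–1 loss, i.e. the probability under $(x,y)\sim\mathbb{P}_{(X,Y)}$ that the predicted label differs from $y$. The empirical margin loss is $\mathcal{R}^{(\rho)}_{S\setminus S_{\alpha m}}[f]=\frac1{m_\sigma}\sum_{i=\alpha m+1}^m\mathcal{L}_{\mathrm{margin},\rho}(f(x_i),y_i)$, where $\mathcal{L}_{\mathrm{margin},\rho}(f(x),y)=\mathcal{L}^{(2)}_{\mathrm{margin},\rho}\big(\mathcal{L}^{(1)}_{\mathrm{margin},\rho}(f(x),y)\big)$, $\mathcal{L}^{(1)}_{\mathrm{margin},\rho}(f(x),y)=z_y^{[L]}(x)-\max_{y'\ne y}z_{y'}^{[L]}(x)$, and $\mathcal{L}^{(2)}_{\mathrm{margin},\rho}(t)=0$ if $\rho\le t$, $=1-t/\rho$ if $0\le t\le\rho$, $=1$ if $t\le0$. *)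

theory Defs
  imports "HOL-Probability.Probability"
begin

text \<open>
  A vector of length \<open>N\<close> is a function on \<open>nat\<close> of which only the entries in \<open>{1..N}\<close> matter.
  Layer \<open>l\<close> has width \<open>n l\<close>, and \<open>W w l l' i i'\<close> is the entry in row \<open>i\<close> and column \<open>i'\<close> of
  the weight matrix from layer \<open>l'\<close> to layer \<open>l\<close> determined by the parameter \<open>w\<close>.
\<close>

type_synonym vec = "nat \<Rightarrow> real"
type_synonym path = "(nat \<times> nat) list"

type_synonym 'w weights = "'w \<Rightarrow> nat \<Rightarrow> nat \<Rightarrow> nat \<Rightarrow> nat \<Rightarrow> real"
type_synonym nonlinearity = "vec \<Rightarrow> vec"
type_synonym 'w masks = "nat \<Rightarrow> vec \<Rightarrow> 'w \<Rightarrow> vec"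

abbreviation vec_space :: "nat \<Rightarrow> vec measure" where
  "vec_space N \<equiv> Pi\<^sub>M {1..N} (\<lambda>_. borel)"

fun preact :: "(nat \<Rightarrow> nat) \<Rightarrow> 'w weights \<Rightarrow> (nat \<Rightarrow> nonlinearity) \<Rightarrow> nat \<Rightarrow> vec \<Rightarrow> 'w \<Rightarrow> vec" where
  "preact n W \<sigma> l x w = (\<lambda>i. \<Sum>l' \<in> {..<l}. \<Sum>i' = 1..n l'.
     W w l l' i i' * (if l' = 0 then x else \<sigma> l' (preact n W \<sigma> l' x w)) i')"

declare preact.simps [simp del]

definition is_relu :: "nat \<Rightarrow> nonlinearity \<Rightarrow> bool" where
  "is_relu N \<phi> \<longleftrightarrow> (\<forall>z. \<forall>i \<in> {1..N}. \<phi> z i = max 0 (z i))"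

text \<open>
  Max pooling is taken in the form that keeps the number of units: in each pool one unit attaining
  the maximum keeps its value, and the other units of the pool are set to 0. The choice among
  several maximal units is left open.
\<close>

definition is_max_pooling :: "nat \<Rightarrow> nonlinearity \<Rightarrow> bool" where
  "is_max_pooling N \<phi> \<longleftrightarrow> (\<exists>pools. partition_on {1..N} pools \<and>
     (\<forall>z. \<forall>P \<in> pools. \<exists>i \<in> P. z i = Max (z ` P) \<and> \<phi> z i = z i \<and> (\<forall>j \<in> P - {i}. \<phi> z j = 0)))"

definition is_relu_or_max_pooling :: "nat \<Rightarrow> nonlinearity \<Rightarrow> bool" where
  "is_relu_or_max_pooling N \<phi> \<longleftrightarrow> is_relu N \<phi> \<or> is_max_pooling N \<phi> \<or>
     (\<exists>\<phi>\<^sub>1 \<phi>\<^sub>2. is_relu N \<phi>\<^sub>1 \<and> is_max_pooling N \<phi>\<^sub>2 \<and> (\<forall>z. \<forall>i \<in> {1..N}. \<phi> z i = \<phi>\<^sub>2 (\<phi>\<^sub>1 z) i))"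

text \<open>
  The masks \<open>d\<sigma> l x w\<close> stand for the 0-1 vectors by which the nonlinearities multiply the
  pre-activations. They are a separate parameter because the nonlinearity does not determine them
  where a pre-activation vanishes.
\<close>

definition network ::
  "nat \<Rightarrow> (nat \<Rightarrow> nat) \<Rightarrow> 'w weights \<Rightarrow> (nat \<Rightarrow> nonlinearity) \<Rightarrow> 'w masks \<Rightarrow> bool" where
  "network L n W \<sigma> d\<sigma> \<longleftrightarrow> 1 \<le> L \<and>
     (\<forall>l \<in> {1..<L}. is_relu_or_max_pooling (n l) (\<sigma> l)) \<and>
     (\<forall>l \<in> {1..<L}. \<forall>x \<in> space (vec_space (n 0)). \<forall>w. \<forall>i \<in> {1..n l}.
        d\<sigma> l x w i \<in> {0, 1} \<and>
        \<sigma> l (preact n W \<sigma> l x w) i = d\<sigma> l x w i * preact n W \<sigma> l x w i)"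

text \<open>A path is the list of pairs \<open>(l\<^sub>s, i\<^sub>s)\<close> of a layer and a unit in it, for \<open>s = 0, \<dots>, h\<close>.\<close>

definition paths :: "nat \<Rightarrow> (nat \<Rightarrow> nat) \<Rightarrow> path set" where
  "paths L n = {p. p \<noteq> [] \<and> fst (hd p) = 0 \<and> sorted_wrt (<) (map fst p) \<and>
     (\<forall>(l, i) \<in> set p. l < L \<and> i \<in> {1..n l})}"

definition path_input :: "vec \<Rightarrow> path \<Rightarrow> real" where
  "path_input x p = x (snd (hd p))"

definition path_mask :: "'w masks \<Rightarrow> vec \<Rightarrow> 'w \<Rightarrow> path \<Rightarrow> real" where
  "path_mask d\<sigma> x w p = (\<Prod>(l, i) \<leftarrow> tl p. d\<sigma> l x w i)"

definition path_weight :: "'w weights \<Rightarrow> nat \<Rightarrow> 'w \<Rightarrow> nat \<Rightarrow> path \<Rightarrow> real" where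
  "path_weight W L w k p = W w L (fst (last p)) k (snd (last p)) *
     (\<Prod>s \<in> {1..<length p}. W w (fst (p ! s)) (fst (p ! (s - 1))) (snd (p ! s)) (snd (p ! (s - 1))))"

definition path_features :: "'w masks \<Rightarrow> 'w \<Rightarrow> vec \<Rightarrow> path \<Rightarrow> real" where
  "path_features d\<sigma> w x p = path_input x p * path_mask d\<sigma> x w p"

lemma path_weight_single:
  "path_weight W L w k [(l, i)] = W w L l k i"
  by (simp add: path_weight_def)

lemma path_weight_snoc:
  assumes "q \<noteq> []"
  shows "path_weight W L w k (q @ [(l, i)]) = W w L l k i * path_weight W l w i q"
proof -
  obtain N where N: "length q = Suc N"
    using assms by (cases q) auto
  have "(\<Prod>s \<in> {1..<length q}. W w (fst ((q @ [(l, i)]) ! s)) (fst ((q @ [(l, i)]) ! (s - 1)))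
            (snd ((q @ [(l, i)]) ! s)) (snd ((q @ [(l, i)]) ! (s - 1)))) =
        (\<Prod>s \<in> {1..<length q}. W w (fst (q ! s)) (fst (q ! (s - 1))) (snd (q ! s)) (snd (q ! (s - 1))))"
    by (intro prod.cong) (auto simp: nth_append)
  moreover have "last q = q ! N"
    using N assms by (simp add: last_conv_nth)
  ultimately show ?thesis
    unfolding path_weight_def using N by (simp add: nth_append)
qed

lemma path_features_snoc:
  assumes "q \<noteq> []"
  shows "path_features d\<sigma> w x (q @ [(l, i)]) = path_features d\<sigma> w x q * d\<sigma> l x w i"
  using assms by (simp add: path_features_def path_input_def path_mask_def)

lemma finite_paths: "finite (paths L n)"
proof (rule finite_subset)
  let ?A = "SIGMA l:{..<L}. {1..n l}"
  show "paths L n \<subseteq> {p. set p \<subseteq> ?A \<and> distinct p}"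
  proof
    fix p assume "p \<in> paths L n"
    then show "p \<in> {p. set p \<subseteq> ?A \<and> distinct p}"
      by (auto simp: paths_def strict_sorted_iff distinct_map)
  qed
  show "finite {p. set p \<subseteq> ?A \<and> distinct p}"
    by (rule finite_subset_distinct) auto
qed

lemma paths_decomp:
  assumes "l > 0"
  shows "paths l n = (\<lambda>i. [(0, i)]) ` {1..n 0} \<union>
    (\<lambda>(l', i, q). q @ [(l', i)]) ` (SIGMA l':{1..<l}. {1..n l'} \<times> paths l' n)" (is "_ = ?A \<union> ?B")
proof (intro equalityI subsetI)
  fix p assume p: "p \<in> paths l n"
  then obtain q l' i where pq: "p = q @ [(l', i)]"
    by (cases p rule: rev_cases) (auto simp: paths_def)
  show "p \<in> ?A \<union> ?B"
  proof (cases "q = []")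
    case True
    then show ?thesis using p pq by (auto simp: paths_def)
  next
    case False
    have below: "fst u < l'" if "u \<in> set q" for u
      using p pq that by (auto simp: paths_def sorted_wrt_append)
    have "q \<in> paths l' n"
      using p pq False below by (fastforce simp: paths_def sorted_wrt_append)
    moreover have "0 < l'"
      using below[OF hd_in_set[OF False]] by simp
    moreover have "l' < l" "i \<in> {1..n l'}"
      using p pq by (auto simp: paths_def)
    ultimately have "(l', i, q) \<in> (SIGMA l':{1..<l}. {1..n l'} \<times> paths l' n)" by auto
    then show ?thesis using pq by force
  qed
next
  fix p assume "p \<in> ?A \<union> ?B"
  then consider i where "p = [(0, i)]" "i \<in> {1..n 0}"
    | l' i q where "p = q @ [(l', i)]" "l' \<in> {1..<l}" "i \<in> {1..n l'}" "q \<in> paths l' n"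
    by auto
  then show "p \<in> paths l n"
  proof cases
    case 1
    then show ?thesis using assms by (auto simp: paths_def)
  next
    case 2
    then show ?thesis by (fastforce simp: paths_def sorted_wrt_append)
  qed
qed

lemma preact_eq_sum_paths:
  assumes net: "network L n W \<sigma> d\<sigma>" and x: "x \<in> space (vec_space (n 0))"
    and "1 \<le> l" "l \<le> L"
  shows "preact n W \<sigma> l x w k = (\<Sum>p \<in> paths l n. path_features d\<sigma> w x p * path_weight W l w k p)"
  using assms(3,4)
proof (induction l arbitrary: k rule: less_induct)
  case (less l)
  define g where "g p = path_features d\<sigma> w x p * path_weight W l w k p" for p
  let ?S = "SIGMA l':{1..<l}. {1..n l'} \<times> paths l' n"
  have ne: "q \<noteq> []" if "q \<in> paths l' n" for q l'
    using that by (auto simp: paths_def)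
  have eq: "(\<Sum>i' = 1..n l'. W w l l' k i' * \<sigma> l' (preact n W \<sigma> l' x w) i') =
      (\<Sum>i' = 1..n l'. \<Sum>q \<in> paths l' n. g (q @ [(l', i')]))" if l': "l' \<in> {1..<l}" for l'
  proof (rule sum.cong[OF refl])
    fix i' assume i': "i' \<in> {1..n l'}"
    have "\<sigma> l' (preact n W \<sigma> l' x w) i' = d\<sigma> l' x w i' * preact n W \<sigma> l' x w i'"
      using net x l' i' less.prems unfolding network_def by auto
    also have "preact n W \<sigma> l' x w i' =
        (\<Sum>q \<in> paths l' n. path_features d\<sigma> w x q * path_weight W l' w i' q)"
      using less.IH[of l'] l' less.prems by auto
    finally show "W w l l' k i' * \<sigma> l' (preact n W \<sigma> l' x w) i' =
        (\<Sum>q \<in> paths l' n. g (q @ [(l', i')]))"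
      by (simp add: g_def sum_distrib_left path_features_snoc path_weight_snoc ne mult_ac)
  qed
  have "{..<l} = insert 0 {1..<l}" using less.prems by auto
  then have "preact n W \<sigma> l x w k = (\<Sum>i' = 1..n 0. W w l 0 k i' * x i') +
      (\<Sum>l' \<in> {1..<l}. \<Sum>i' = 1..n l'. W w l l' k i' * \<sigma> l' (preact n W \<sigma> l' x w) i')"
    by (subst preact.simps) simp
  also have "(\<Sum>i' = 1..n 0. W w l 0 k i' * x i') = (\<Sum>i' = 1..n 0. g [(0, i')])"
    by (simp add: g_def path_features_def path_input_def path_mask_def path_weight_single mult.commute)
  also have "\<dots> = sum g ((\<lambda>i. [(0, i)]) ` {1..n 0})"
    by (subst sum.reindex) (auto simp: inj_on_def)
  also have "(\<Sum>l' \<in> {1..<l}. \<Sum>i' = 1..n l'. W w l l' k i' * \<sigma> l' (preact n W \<sigma> l' x w) i') =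
      (\<Sum>l' \<in> {1..<l}. \<Sum>(i', q) \<in> {1..n l'} \<times> paths l' n. g (q @ [(l', i')]))"
    by (rule sum.cong[OF refl], subst eq) (simp_all add: sum.cartesian_product)
  also have "\<dots> = (\<Sum>(l', i', q) \<in> ?S. g (q @ [(l', i')]))"
    by (subst sum.Sigma) (auto simp: finite_paths split_def)
  also have "\<dots> = sum g ((\<lambda>(l', i, q). q @ [(l', i)]) ` ?S)"
    by (subst sum.reindex) (auto simp: inj_on_def split_def)
  finally have "preact n W \<sigma> l x w k = sum g ((\<lambda>i. [(0, i)]) ` {1..n 0}) +
      sum g ((\<lambda>(l', i, q). q @ [(l', i)]) ` ?S)" .
  also have "\<dots> = sum g (paths l n)"
    unfolding paths_decomp[of l n, OF order.strict_trans2[OF zero_less_one less.prems(1)]]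
    by (rule sum.union_disjoint[symmetric]) (auto simp: finite_paths dest: ne)
  finally show ?case by (simp add: g_def)
qed

text \<open>
  The path weights are free vectors, not necessarily products of entries of weight matrices. By
  \<open>preact_eq_sum_paths\<close> the network with parameter \<open>w\<^sub>\<sigma>\<close> itself is the instance
  \<open>wbar = path_weight W L w\<^sub>\<sigma>\<close>.
\<close>

definition path_model ::
  "nat \<Rightarrow> (nat \<Rightarrow> nat) \<Rightarrow> 'w masks \<Rightarrow> 'w \<Rightarrow> (nat \<Rightarrow> path \<Rightarrow> real) \<Rightarrow> vec \<Rightarrow> vec" where
  "path_model L n d\<sigma> w\<^sub>\<sigma> wbar x k = (\<Sum>p \<in> paths L n. path_features d\<sigma> w\<^sub>\<sigma> x p * wbar k p)"

definition two_phase_models ::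
  "nat \<Rightarrow> (nat \<Rightarrow> nat) \<Rightarrow> 'w masks \<Rightarrow> 'w \<Rightarrow> (nat \<Rightarrow> path \<Rightarrow> real) set \<Rightarrow> (vec \<Rightarrow> vec) set" where
  "two_phase_models L n d\<sigma> w\<^sub>\<sigma> allowed = path_model L n d\<sigma> w\<^sub>\<sigma> ` allowed"

text \<open>Ties are broken by the unspecified choice in \<open>arg_max_on\<close>.\<close>

definition predicted_label :: "nat \<Rightarrow> vec \<Rightarrow> nat" where
  "predicted_label dy z = arg_max_on z {1..dy}"

definition risk :: "nat \<Rightarrow> (vec \<times> nat) measure \<Rightarrow> (vec \<Rightarrow> vec) \<Rightarrow> real" where
  "risk dy D f = measure D {(x, y) \<in> space D. predicted_label dy (f x) \<noteq> y}"

definition margin :: "nat \<Rightarrow> vec \<Rightarrow> nat \<Rightarrow> real" where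
  "margin dy z y = z y - Max (z ` ({1..dy} - {y}))"

definition ramp :: "real \<Rightarrow> real \<Rightarrow> real" where
  "ramp \<rho> t = (if \<rho> \<le> t then 0 else if 0 \<le> t then 1 - t / \<rho> else 1)"

definition margin_loss :: "nat \<Rightarrow> real \<Rightarrow> vec \<Rightarrow> nat \<Rightarrow> real" where
  "margin_loss dy \<rho> z y = ramp \<rho> (margin dy z y)"

definition empirical_margin_loss ::
  "nat \<Rightarrow> real \<Rightarrow> nat set \<Rightarrow> (nat \<Rightarrow> vec \<times> nat) \<Rightarrow> (vec \<Rightarrow> vec) \<Rightarrow> real" where
  "empirical_margin_loss dy \<rho> I s f =
     (\<Sum>i \<in> I. margin_loss dy \<rho> (f (fst (s i))) (snd (s i))) / real (card I)"

abbreviation example_space :: "nat \<Rightarrow> nat \<Rightarrow> (vec \<times> nat) measure" where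
  "example_space n0 dy \<equiv> vec_space n0 \<Otimes>\<^sub>M count_space {1..dy}"

definition subsample :: "nat set \<Rightarrow> (nat \<Rightarrow> 'o \<Rightarrow> 'z) \<Rightarrow> 'o \<Rightarrow> nat \<Rightarrow> 'z" where
  "subsample I Z \<omega> = (\<lambda>i \<in> I. Z i \<omega>)"

text \<open>
  Stated through a measurable subset of the event, since an event quantifying over an uncountable
  set of models is not obviously measurable.
\<close>

definition holds_with_prob_at_least :: "'s measure \<Rightarrow> real \<Rightarrow> ('s \<Rightarrow> bool) \<Rightarrow> bool" where
  "holds_with_prob_at_least P p Q \<longleftrightarrow> (\<exists>G \<in> sets P. p \<le> measure P G \<and> (\<forall>s \<in> G. Q s))"

end

theory Submission
  imports Defs
begin

text \<open>
  The 0-1 loss is at most the margin loss, which is \<open>1/\<rho>\<close>-Lipschitz in the outputs for the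
  \<open>\<ell>\<^sub>1\<close> norm. McDiarmid's inequality reduces the uniform deviation to its expectation. Instead
  of independent Rademacher signs for all outputs, each sample point carries one random sign and
  one uniformly chosen output, rescaled by \<open>d\<^sub>y\<close>; with these, symmetrization and contraction are
  carried out together, one sample point at a time. The remaining linear process is bounded by
  Cauchy--Schwarz and the second moment of the path features. All suprema are taken over finite
  sets of models; a countable dense set of path weights gives the passage to the whole class.
\<close>

text \<open>The features have only a second moment, so outputs and linear process may be unbounded.
  McDiarmid is therefore applied to the losses, which lie in [0,1], and the features enter through
  an expectation alone. Drawing one output per point suits the \<open>\<ell>\<^sub>1\<close> norm:
  the average over the drawn output lets each output choose its own assignment of signs to two
  competing models, and the gains add up to the full \<open>\<ell>\<^sub>1\<close> distance. It also
  turns the passage to signs into the replacement of one i.i.d. sample by another, which can be made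
  coordinate by coordinate. In the constant 2 \<open>d\<^sub>y\<^sup>2\<close> / \<rho>, the 2 comes
  from symmetrization, one factor \<open>d\<^sub>y\<close> from the rescaling, and the other from
  adding one Cauchy-Schwarz bound per output.\<close>

section \<open>McDiarmid's inequality\<close>

text \<open>Bounded oscillation places the values in an interval of length \<open>c\<close> starting
  at the infimum, and Hoeffding's bound depends on the length only. The position is left open
  because in the induction below it varies with the remaining coordinates.\<close>

lemma Hoeffding_mgf_oscillation:
  fixes X :: "'a \<Rightarrow> real"
  assumes D: "prob_space D" and X[measurable]: "X \<in> borel_measurable D" and l: "0 < l"
    and osc: "\<And>y z. y \<in> space D \<Longrightarrow> z \<in> space D \<Longrightarrow> \<bar>X y - X z\<bar> \<le> c"
  shows "(\<integral>z. exp (l * (X z - (\<integral>z. X z \<partial>D))) \<partial>D) \<le> exp (l\<^sup>2 * c\<^sup>2 / 8)"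
proof -
  interpret D: prob_space D by fact
  obtain y where y: "y \<in> space D" using D.not_empty by auto
  define a where "a = (INF z\<in>space D. X z)"
  have bdd: "bdd_below (X ` space D)"
    using osc[OF _ y] by (intro bdd_belowI[of _ "X y - c"]) (force simp: abs_le_iff)
  have lower: "a \<le> X z" if "z \<in> space D" for z
    unfolding a_def using bdd that by (rule cINF_lower)
  have upper: "X z \<le> a + c" if z: "z \<in> space D" for z
  proof -
    have "X z - c \<le> a"
      unfolding a_def using osc[OF z] y by (intro cINF_greatest) (force simp: abs_le_iff)+
    then show ?thesis by simp
  qed
  interpret X: interval_bounded_random_variable D X a "a + c"
    by unfold_locales (use lower upper in auto)
  have "(\<integral>\<^sup>+z. exp (l * (X z - (\<integral>z. X z \<partial>D))) \<partial>D) \<le> ennreal (exp (l\<^sup>2 * c\<^sup>2 / 8))"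
    using X.Hoeffdings_lemma_nn_integral[OF l] by simp
  then show ?thesis
    by (intro integral_real_bounded) auto
qed

text \<open>The martingale argument as an induction over coordinates. Averaging out coordinate
  \<open>j\<close> gives the conditional mean \<open>G\<close>. For fixed other coordinates
  \<open>g - G\<close> is centered with oscillation at most \<open>c\<close>, so Hoeffding
  contributes one factor, while \<open>G\<close> inherits the bounded differences and is handled by
  the induction hypothesis. \<open>B\<close> serves integrability and does not enter the
  estimate.\<close>

lemma bounded_difference_mgf:
  fixes g :: "('i \<Rightarrow> 'a) \<Rightarrow> real"
  assumes D: "prob_space D" and I: "finite I" and l: "0 < l"
    and g: "g \<in> borel_measurable (Pi\<^sub>M I (\<lambda>_. D))"
    and bounded: "\<And>s. s \<in> space (Pi\<^sub>M I (\<lambda>_. D)) \<Longrightarrow> \<bar>g s\<bar> \<le> B"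
    and diff: "\<And>s i z. s \<in> space (Pi\<^sub>M I (\<lambda>_. D)) \<Longrightarrow> i \<in> I \<Longrightarrow> z \<in> space D \<Longrightarrow> \<bar>g (s(i := z)) - g s\<bar> \<le> c"
  shows "(\<integral>s. exp (l * (g s - (\<integral>s. g s \<partial>Pi\<^sub>M I (\<lambda>_. D)))) \<partial>Pi\<^sub>M I (\<lambda>_. D))
           \<le> exp (real (card I) * (l\<^sup>2 * c\<^sup>2 / 8))"
  using I g bounded diff
proof (induction I arbitrary: g rule: finite_induct)
  case empty
  let ?P = "Pi\<^sub>M {} (\<lambda>_. D) :: ('i \<Rightarrow> 'a) measure"
  interpret P: prob_space ?P using D by (intro prob_space_PiM)
  have eq: "g s = g (\<lambda>_. undefined)" if "s \<in> space (?P)" for s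
    using that by (simp add: space_PiM)
  have "(\<integral>s. g s \<partial>?P) = (\<integral>s. g (\<lambda>_. undefined) \<partial>?P)"
    by (rule Bochner_Integration.integral_cong[OF refl eq])
  then have *: "(\<integral>s. g s \<partial>?P) = g (\<lambda>_. undefined)" by (simp add: P.prob_space)
  have "(\<integral>s. exp (l * (g s - g (\<lambda>_. undefined))) \<partial>?P) = (\<integral>s. 1 \<partial>?P)"
    by (rule Bochner_Integration.integral_cong[OF refl]) (auto dest: eq)
  then show ?case unfolding * by (simp add: P.prob_space)
next
  case (insert j I)
  note [measurable] = insert.prems(1)
  interpret D: prob_space D by fact
  interpret P: product_prob_space "\<lambda>_. D" I by standard
  interpret P': product_prob_space "\<lambda>_. D" "insert j I" by standard
  let ?P = "Pi\<^sub>M I (\<lambda>_. D)" and ?P' = "Pi\<^sub>M (insert j I) (\<lambda>_. D)"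
  define G where "G s = (\<integral>z. g (s(j := z)) \<partial>D)" for s
  have upd[measurable]: "(\<lambda>(s, z). s(j := z)) \<in> ?P \<Otimes>\<^sub>M D \<rightarrow>\<^sub>M ?P'"
    by measurable
  have space_upd: "s(j := z) \<in> space ?P'" if "s \<in> space ?P" "z \<in> space D" for s z
    using that by (auto simp: space_PiM PiE_def extensional_def)
  have slice[measurable]: "(\<lambda>z. g (s(j := z))) \<in> borel_measurable D" if "s \<in> space ?P" for s
    using that by measurable
  have G[measurable]: "G \<in> borel_measurable ?P"
    unfolding G_def by measurable
  have int_slice: "integrable D (\<lambda>z. g (s(j := z)))" if s: "s \<in> space ?P" for s
    by (rule D.integrable_const_bound[of _ B])
       (auto intro!: insert.prems(2) space_upd s slice)
  have G_bounded: "\<bar>G s\<bar> \<le> B" if s: "s \<in> space ?P" for s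
  proof -
    have "norm (G s) \<le> (\<integral>z. norm (g (s(j := z))) \<partial>D)" unfolding G_def by (rule integral_norm_bound)
    also have "\<dots> \<le> (\<integral>z. B \<partial>D)"
      using int_slice[OF s] by (intro integral_mono) (auto intro!: insert.prems(2) space_upd s)
    finally show ?thesis by (simp add: D.prob_space)
  qed
  have G_diff: "\<bar>G (s(i := y)) - G s\<bar> \<le> c" if s: "s \<in> space ?P" and i: "i \<in> I" and y: "y \<in> space D" for s i y
  proof -
    have ij: "i \<noteq> j" using i insert.hyps by auto
    have s': "s(i := y) \<in> space ?P"
      using s i y by (auto simp: space_PiM PiE_def extensional_def)
    have "norm (G (s(i := y)) - G s) = norm (\<integral>z. g (s(i := y, j := z)) - g (s(j := z)) \<partial>D)"
      unfolding G_def using int_slice[OF s] int_slice[OF s'] by simp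
    also have "\<dots> \<le> (\<integral>z. norm (g (s(i := y, j := z)) - g (s(j := z))) \<partial>D)"
      by (rule integral_norm_bound)
    also have "\<dots> \<le> (\<integral>z. c \<partial>D)"
    proof (rule integral_mono)
      show "integrable D (\<lambda>z. norm (g (s(i := y, j := z)) - g (s(j := z))))"
        using int_slice[OF s] int_slice[OF s'] by auto
      fix z assume z: "z \<in> space D"
      show "norm (g (s(i := y, j := z)) - g (s(j := z))) \<le> c"
        unfolding fun_upd_twist[OF ij] real_norm_def
        using i y by (intro insert.prems(3) space_upd s z) auto
    qed simp
    finally show ?thesis by (simp add: D.prob_space)
  qed
  have int_g: "integrable ?P' g"
    by (rule P'.integrable_const_bound[of _ B]) (auto intro!: insert.prems(2))
  have int_exp: "integrable ?P' (\<lambda>s. exp (l * (g s - a)))" for a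
  proof (rule P'.integrable_const_bound[of _ "exp (l * (B - a))"])
    show "AE s in ?P'. norm (exp (l * (g s - a))) \<le> exp (l * (B - a))"
      using insert.prems(2) l by (intro AE_I2) (auto simp: abs_le_iff)
  qed simp
  have Eg: "(\<integral>s. g s \<partial>?P') = (\<integral>s. G s \<partial>?P)"
    unfolding G_def by (rule P.product_integral_insert) (use insert.hyps int_g in auto)
  define a where "a = (\<integral>s. G s \<partial>?P)"
  have int_expG: "integrable ?P (\<lambda>s. exp (l * (G s - a)))"
  proof (rule P.integrable_const_bound[of _ "exp (l * (B - a))"])
    show "AE s in ?P. norm (exp (l * (G s - a))) \<le> exp (l * (B - a))"
      using G_bounded l by (intro AE_I2) (auto simp: abs_le_iff)
  qed simp
  have "(\<integral>s. exp (l * (g s - a)) \<partial>?P') = (\<integral>s. (\<integral>z. exp (l * (g (s(j := z)) - a)) \<partial>D) \<partial>?P)"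
    by (rule P.product_integral_insert) (use insert.hyps int_exp in auto)
  also have "\<dots> \<le> (\<integral>s. exp (l\<^sup>2 * c\<^sup>2 / 8) * exp (l * (G s - a)) \<partial>?P)"
  proof (rule integral_mono')
    show "integrable ?P (\<lambda>s. exp (l\<^sup>2 * c\<^sup>2 / 8) * exp (l * (G s - a)))"
      using int_expG by simp
    fix s assume s: "s \<in> space ?P"
    \<comment> \<open>The exponent is split at the conditional mean \<open>G s\<close>; the second
      factor is constant in \<open>z\<close> and leaves the inner integral.\<close>
    have "(\<integral>z. exp (l * (g (s(j := z)) - a)) \<partial>D) =
        (\<integral>z. exp (l * (g (s(j := z)) - G s)) * exp (l * (G s - a)) \<partial>D)"
      by (intro Bochner_Integration.integral_cong) (auto simp flip: exp_add simp: algebra_simps)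
    also have "\<dots> = (\<integral>z. exp (l * (g (s(j := z)) - G s)) \<partial>D) * exp (l * (G s - a))"
      by simp
    also have "(\<integral>z. exp (l * (g (s(j := z)) - G s)) \<partial>D) \<le> exp (l\<^sup>2 * c\<^sup>2 / 8)"
      unfolding G_def
    proof (rule Hoeffding_mgf_oscillation[OF D slice[OF s] l])
      fix y z assume yz: "y \<in> space D" "z \<in> space D"
      show "\<bar>g (s(j := y)) - g (s(j := z))\<bar> \<le> c"
      proof -
        have "\<bar>g ((s(j := z))(j := y)) - g (s(j := z))\<bar> \<le> c"
          using yz by (intro insert.prems(3) space_upd s) auto
        then show ?thesis by simp
      qed
    qed
    finally show "(\<integral>z. exp (l * (g (s(j := z)) - a)) \<partial>D) \<le> exp (l\<^sup>2 * c\<^sup>2 / 8) * exp (l * (G s - a))"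
      by simp
  qed simp
  also have "\<dots> = exp (l\<^sup>2 * c\<^sup>2 / 8) * (\<integral>s. exp (l * (G s - a)) \<partial>?P)" by simp
  also have "\<dots> \<le> exp (l\<^sup>2 * c\<^sup>2 / 8) * exp (real (card I) * (l\<^sup>2 * c\<^sup>2 / 8))"
    unfolding a_def using insert.IH[OF G G_bounded G_diff] by simp
  also have "\<dots> = exp (real (card (insert j I)) * (l\<^sup>2 * c\<^sup>2 / 8))"
    using insert.hyps by (simp flip: exp_add add: algebra_simps add_divide_distrib)
  finally show ?case unfolding Eg a_def .
qed

theorem McDiarmid_ineq:
  fixes g :: "('i \<Rightarrow> 'a) \<Rightarrow> real"
  assumes D: "prob_space D" and I: "finite I" "I \<noteq> {}" and c: "0 < c"
    and g[measurable]: "g \<in> borel_measurable (Pi\<^sub>M I (\<lambda>_. D))"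
    and bounded: "\<And>s. s \<in> space (Pi\<^sub>M I (\<lambda>_. D)) \<Longrightarrow> \<bar>g s\<bar> \<le> B"
    and diff: "\<And>s i z. s \<in> space (Pi\<^sub>M I (\<lambda>_. D)) \<Longrightarrow> i \<in> I \<Longrightarrow> z \<in> space D \<Longrightarrow> \<bar>g (s(i := z)) - g s\<bar> \<le> c"
    and eps: "0 < \<epsilon>"
  shows "measure (Pi\<^sub>M I (\<lambda>_. D))
      {s \<in> space (Pi\<^sub>M I (\<lambda>_. D)). (\<integral>s. g s \<partial>Pi\<^sub>M I (\<lambda>_. D)) + \<epsilon> \<le> g s} \<le> exp (- 2 * \<epsilon>\<^sup>2 / (real (card I) * c\<^sup>2))"
proof -
  let ?P = "Pi\<^sub>M I (\<lambda>_. D)"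
  interpret P: prob_space ?P using D by (intro prob_space_PiM)
  define N where "N = real (card I)"
  define a where "a = (\<integral>s. g s \<partial>?P)"
  \<comment> \<open>The minimizer of the Chernoff exponent
    \<open>- l * \<epsilon> + N * l\<^sup>2 * c\<^sup>2 / 8\<close>.\<close>
  define l where "l = 4 * \<epsilon> / (N * c\<^sup>2)"
  have N: "0 < N" using I by (simp add: N_def card_gt_0_iff)
  have l: "0 < l" using N c eps by (simp add: l_def)
  have int: "integrable ?P (\<lambda>s. exp (l * (g s - a)))"
  proof (rule P.integrable_const_bound[of _ "exp (l * (B - a))"])
    show "AE s in ?P. norm (exp (l * (g s - a))) \<le> exp (l * (B - a))"
      using bounded l by (intro AE_I2) (auto simp: abs_le_iff)
  qed simp
  have "measure ?P {s \<in> space ?P. a + \<epsilon> \<le> g s} = measure ?P {s \<in> space ?P. g s - a \<ge> \<epsilon>}"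
    by (intro arg_cong[where f = "measure ?P"]) auto
  also have "\<dots> \<le> exp (- l * \<epsilon>) * (\<integral>s\<in>space ?P. exp (l * (g s - a)) \<partial>?P)"
    using int by (intro P.Chernoff_ineq_ge l) (auto simp: set_integrable_def cong: Bochner_Integration.integrable_cong)
  also have "(\<integral>s\<in>space ?P. exp (l * (g s - a)) \<partial>?P) = (\<integral>s. exp (l * (g s - a)) \<partial>?P)"
    unfolding set_lebesgue_integral_def by (intro Bochner_Integration.integral_cong) auto
  also have "\<dots> \<le> exp (N * (l\<^sup>2 * c\<^sup>2 / 8))"
    unfolding a_def N_def using bounded diff by (intro bounded_difference_mgf[OF D I(1) l g])
  also have "exp (- l * \<epsilon>) * exp (N * (l\<^sup>2 * c\<^sup>2 / 8)) = exp (- 2 * \<epsilon>\<^sup>2 / (N * c\<^sup>2))"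
    using N c by (simp flip: exp_add add: l_def power2_eq_square field_simps)
  finally show ?thesis unfolding a_def N_def by simp
qed

section \<open>Symmetrization and contraction\<close>

lemma integrable_MAX:
  fixes f :: "'t \<Rightarrow> 'a \<Rightarrow> real"
  assumes "finite T" "T \<noteq> {}" "\<And>t. t \<in> T \<Longrightarrow> integrable M (f t)"
  shows "integrable M (\<lambda>x. MAX t\<in>T. f t x)"
  using assms
proof (induction T rule: finite_ne_induct)
  case (insert t T)
  then have "integrable M (\<lambda>x. max (f t x) (MAX t\<in>T. f t x))" by (intro integrable_max) auto
  also have "(\<lambda>x. max (f t x) (MAX t\<in>T. f t x)) = (\<lambda>x. MAX t\<in>insert t T. f t x)"
    using insert.hyps by simp
  finally show ?case .
qed simp

lemma integrable_sum_PiM: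
  fixes u :: "'a \<Rightarrow> real"
  assumes "prob_space D" "finite I" "integrable D u"
  shows "integrable (Pi\<^sub>M I (\<lambda>_. D)) (\<lambda>s. \<Sum>i\<in>I. u (s i))"
proof (intro Bochner_Integration.integrable_sum)
  fix i assume i: "i \<in> I"
  interpret D: prob_space D by fact
  interpret P: product_prob_space "\<lambda>_. D" I by standard
  have "integrable (distr (Pi\<^sub>M I (\<lambda>_. D)) D (\<lambda>s. s i)) u"
    using P.PiM_component[OF i] assms by simp
  then show "integrable (Pi\<^sub>M I (\<lambda>_. D)) (\<lambda>s. u (s i))"
    using i assms by (subst (asm) integrable_distr_eq) auto
qed

lemma integrable_MAX_pair:
  fixes a :: "'t \<Rightarrow> 'a \<Rightarrow> real" and b :: "'t \<Rightarrow> 'b \<Rightarrow> real"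
  assumes "prob_space P" "prob_space Q" "finite T" "T \<noteq> {}"
    and a: "\<And>t. t \<in> T \<Longrightarrow> integrable P (a t)" and b: "\<And>t. t \<in> T \<Longrightarrow> integrable Q (b t)"
  shows "integrable (P \<Otimes>\<^sub>M Q) (\<lambda>(x, y). MAX t\<in>T. a t x + b t y)"
proof -
  interpret P: prob_space P by fact
  interpret Q: prob_space Q by fact
  interpret S: pair_prob_space Q P ..
  have "integrable (P \<Otimes>\<^sub>M Q) (\<lambda>p. a t (fst p) + b t (snd p))" if t: "t \<in> T" for t
  proof (intro Bochner_Integration.integrable_add)
    have "distr (P \<Otimes>\<^sub>M Q) P fst = P" by (rule Q.distr_pair_fst)
    then show "integrable (P \<Otimes>\<^sub>M Q) (\<lambda>p. a t (fst p))"
      using integrable_distr[of fst "P \<Otimes>\<^sub>M Q" P "a t"] a[OF t] by simp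
    have "distr (P \<Otimes>\<^sub>M Q) Q snd = Q"
    proof (rule measure_eqI)
      fix A assume "A \<in> sets (distr (P \<Otimes>\<^sub>M Q) Q snd)"
      then have A[measurable]: "A \<in> sets Q" by simp
      have "snd -` A \<inter> space (P \<Otimes>\<^sub>M Q) = space P \<times> A"
        using sets.sets_into_space[OF A] by (auto simp: space_pair_measure)
      then show "emeasure (distr (P \<Otimes>\<^sub>M Q) Q snd) A = emeasure Q A"
        by (simp add: emeasure_distr Q.emeasure_pair_measure_Times P.emeasure_space_1)
    qed simp
    then show "integrable (P \<Otimes>\<^sub>M Q) (\<lambda>p. b t (snd p))"
      using integrable_distr[of snd "P \<Otimes>\<^sub>M Q" Q "b t"] b[OF t] by simp
  qed
  then have "integrable (P \<Otimes>\<^sub>M Q) (\<lambda>p. MAX t\<in>T. a t (fst p) + b t (snd p))"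
    using assms by (intro integrable_MAX) auto
  then show ?thesis by (simp add: case_prod_unfold)
qed

text \<open>Exchanges \<open>D\<close> for \<open>D'\<close> one coordinate at a time. The offset
  \<open>A\<close> is what makes this possible: from the viewpoint of one sample point, all other
  points contribute a fixed function of \<open>t\<close>. Hence \<open>step\<close> is required for
  every offset, and the induction hypothesis is used with \<open>h t \<zeta>\<close> added to the
  offset.\<close>

lemma expectation_MAX_sum_le:
  fixes u :: "'t \<Rightarrow> 'a \<Rightarrow> real" and h :: "'t \<Rightarrow> 'b \<Rightarrow> real" and I :: "'i set"
  assumes D: "prob_space D" and D': "prob_space D'" and T: "finite T" "T \<noteq> {}" and I: "finite I"
    and u: "\<And>t. t \<in> T \<Longrightarrow> integrable D (u t)" and h: "\<And>t. t \<in> T \<Longrightarrow> integrable D' (h t)"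
    and step: "\<And>A. (\<integral>z. (MAX t\<in>T. A t + u t z) \<partial>D) \<le> (\<integral>\<zeta>. (MAX t\<in>T. A t + h t \<zeta>) \<partial>D')"
  shows "(\<integral>s. (MAX t\<in>T. A t + (\<Sum>i\<in>I. u t (s i))) \<partial>Pi\<^sub>M I (\<lambda>_. D))
       \<le> (\<integral>s. (MAX t\<in>T. A t + (\<Sum>i\<in>I. h t (s i))) \<partial>Pi\<^sub>M I (\<lambda>_. D'))"
  using I
proof (induction I arbitrary: A rule: finite_induct)
  case empty
  interpret E: prob_space "Pi\<^sub>M {} (\<lambda>_. D) :: ('i \<Rightarrow> 'a) measure" using D by (intro prob_space_PiM)
  interpret E': prob_space "Pi\<^sub>M {} (\<lambda>_. D') :: ('i \<Rightarrow> 'b) measure" using D' by (intro prob_space_PiM)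
  show ?case using E.prob_space E'.prob_space by simp
next
  case (insert j I)
  interpret D: prob_space D by fact
  interpret D': prob_space D' by fact
  interpret P: product_prob_space "\<lambda>_. D" I by standard
  interpret P': product_prob_space "\<lambda>_. D'" I by standard
  let ?P = "Pi\<^sub>M I (\<lambda>_. D)" and ?P' = "Pi\<^sub>M I (\<lambda>_. D')"
  have sum_upd: "(\<Sum>i\<in>insert j I. v ((s(j := z)) i)) = (\<Sum>i\<in>I. v (s i)) + v z"
    for v :: "'c \<Rightarrow> real" and s z
  proof -
    have "(\<Sum>i\<in>I. v ((s(j := z)) i)) = (\<Sum>i\<in>I. v (s i))"
      using insert.hyps by (intro sum.cong) auto
    then show ?thesis using insert.hyps by simp
  qed
  have int_insert: "integrable (Pi\<^sub>M (insert j I) (\<lambda>_. E)) (\<lambda>s. MAX t\<in>T. A t + (\<Sum>i\<in>insert j I. v t (s i)))"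
    if "prob_space E" "\<And>t. t \<in> T \<Longrightarrow> integrable E (v t)" for E :: "'c measure" and v
  proof -
    interpret E: prob_space "Pi\<^sub>M (insert j I) (\<lambda>_. E)" by (intro prob_space_PiM that)
    show ?thesis
      using insert.hyps that T
      by (intro integrable_MAX Bochner_Integration.integrable_add integrable_sum_PiM) auto
  qed
  have int_part: "integrable (Pi\<^sub>M I (\<lambda>_. E)) (\<lambda>s. A t + (\<Sum>i\<in>I. v (s i)))"
    if "prob_space E" "integrable E v" for E :: "'c measure" and v t
  proof -
    interpret E: prob_space "Pi\<^sub>M I (\<lambda>_. E)" by (intro prob_space_PiM that)
    show ?thesis
      using insert.hyps that by (intro Bochner_Integration.integrable_add integrable_sum_PiM) auto
  qed
  interpret PD: pair_sigma_finite ?P D ..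
  interpret PD': pair_sigma_finite ?P D' ..
  interpret P'D': pair_sigma_finite ?P' D' ..
  have int1: "integrable (?P \<Otimes>\<^sub>M D) (\<lambda>(s, z). MAX t\<in>T. A t + (\<Sum>i\<in>I. u t (s i)) + u t z)"
    using D T u by (intro integrable_MAX_pair int_part P.prob_space_axioms)
  \<comment> \<open>The intermediate sample: coordinate \<open>j\<close> is already exchanged, those
    in \<open>I\<close> are not. Fubini then puts the \<open>D'\<close> integral outside, so that
    \<open>\<zeta>\<close> is fixed when the induction hypothesis is applied.\<close>
  have int2: "integrable (?P \<Otimes>\<^sub>M D') (\<lambda>(s, \<zeta>). MAX t\<in>T. A t + (\<Sum>i\<in>I. u t (s i)) + h t \<zeta>)"
    using D D' T u h by (intro integrable_MAX_pair int_part P.prob_space_axioms)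
  have int3: "integrable (?P' \<Otimes>\<^sub>M D') (\<lambda>(s, \<zeta>). MAX t\<in>T. A t + (\<Sum>i\<in>I. h t (s i)) + h t \<zeta>)"
    using D' T h by (intro integrable_MAX_pair int_part P'.prob_space_axioms)
  have "(\<integral>s. (MAX t\<in>T. A t + (\<Sum>i\<in>insert j I. u t (s i))) \<partial>Pi\<^sub>M (insert j I) (\<lambda>_. D)) =
      (\<integral>s. (\<integral>z. (MAX t\<in>T. A t + (\<Sum>i\<in>I. u t (s i)) + u t z) \<partial>D) \<partial>?P)"
    using P.product_integral_insert[OF insert.hyps int_insert, of u] D u by (simp only: sum_upd add.assoc)
  also have "\<dots> \<le> (\<integral>s. (\<integral>\<zeta>. (MAX t\<in>T. A t + (\<Sum>i\<in>I. u t (s i)) + h t \<zeta>) \<partial>D') \<partial>?P)"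
    by (rule integral_mono[OF PD.integrable_fst[OF int1] PD'.integrable_fst[OF int2] step])
  also have "\<dots> = (\<integral>\<zeta>. (\<integral>s. (MAX t\<in>T. A t + (\<Sum>i\<in>I. u t (s i)) + h t \<zeta>) \<partial>?P) \<partial>D')"
    by (rule PD'.Fubini_integral[OF int2, symmetric])
  also have "\<dots> \<le> (\<integral>\<zeta>. (\<integral>s. (MAX t\<in>T. A t + (\<Sum>i\<in>I. h t (s i)) + h t \<zeta>) \<partial>?P') \<partial>D')"
  proof (rule integral_mono[OF PD'.integrable_snd[OF int2] P'D'.integrable_snd[OF int3]])
    fix \<zeta>
    show "(\<integral>s. (MAX t\<in>T. A t + (\<Sum>i\<in>I. u t (s i)) + h t \<zeta>) \<partial>?P)
        \<le> (\<integral>s. (MAX t\<in>T. A t + (\<Sum>i\<in>I. h t (s i)) + h t \<zeta>) \<partial>?P')"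
      using insert.IH[of "\<lambda>t. A t + h t \<zeta>"] by (simp add: ac_simps)
  qed
  also have "\<dots> = (\<integral>s. (\<integral>\<zeta>. (MAX t\<in>T. A t + (\<Sum>i\<in>I. h t (s i)) + h t \<zeta>) \<partial>D') \<partial>?P')"
    by (rule P'D'.Fubini_integral[OF int3])
  also have "\<dots> = (\<integral>s. (MAX t\<in>T. A t + (\<Sum>i\<in>insert j I. h t (s i))) \<partial>Pi\<^sub>M (insert j I) (\<lambda>_. D'))"
    using P'.product_integral_insert[OF insert.hyps int_insert, of h] D' h by (simp only: sum_upd add.assoc)
  finally show ?case .
qed

text \<open>Turns expectations over the auxiliary sign and output into plain finite averages.
  Finiteness of \<open>S\<close> reduces joint measurability and integrability to the single
  slices.\<close>

lemma
  fixes F :: "'q \<Rightarrow> 'a \<Rightarrow> real"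
  assumes D: "prob_space D" and S: "finite S" "S \<noteq> {}" and F: "\<And>q. q \<in> S \<Longrightarrow> integrable D (F q)"
  shows integrable_uniform_pair: "integrable (uniform_count_measure S \<Otimes>\<^sub>M D) (\<lambda>(q, z). F q z)"
    and integral_uniform_pair:
      "(\<integral>(q, z). F q z \<partial>(uniform_count_measure S \<Otimes>\<^sub>M D)) = (\<Sum>q\<in>S. \<integral>z. F q z \<partial>D) / card S"
proof -
  interpret D: prob_space D by fact
  interpret Q: prob_space "uniform_count_measure S"
    using S by (rule prob_space_uniform_count_measure)
  interpret P: pair_sigma_finite "uniform_count_measure S" D ..
  have meas: "(\<lambda>(q, z). F q z) \<in> borel_measurable (uniform_count_measure S \<Otimes>\<^sub>M D)"
  proof -
    have "(\<lambda>(q, z). F q z) \<in> borel_measurable (count_space S \<Otimes>\<^sub>M D)"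
      using S F by (intro measurable_pair_measure_countable1) (auto intro: countable_finite)
    also have "borel_measurable (count_space S \<Otimes>\<^sub>M D) = borel_measurable (uniform_count_measure S \<Otimes>\<^sub>M D)"
      by (intro measurable_cong_sets sets_pair_measure_cong) (simp_all add: sets_uniform_count_measure)
    finally show ?thesis .
  qed
  show int: "integrable (uniform_count_measure S \<Otimes>\<^sub>M D) (\<lambda>(q, z). F q z)"
  proof (rule P.Fubini_integrable[OF meas])
    show "integrable (uniform_count_measure S) (\<lambda>q. \<integral>z. norm (case (q, z) of (q, z) \<Rightarrow> F q z) \<partial>D)"
      unfolding uniform_count_measure_def using S by (intro integrable_point_measure_finite) auto
    show "AE q in uniform_count_measure S. integrable D (\<lambda>z. case (q, z) of (q, z) \<Rightarrow> F q z)"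
      using F by (intro AE_I2) (auto simp: space_uniform_count_measure)
  qed
  show "(\<integral>(q, z). F q z \<partial>(uniform_count_measure S \<Otimes>\<^sub>M D)) = (\<Sum>q\<in>S. \<integral>z. F q z \<partial>D) / card S"
    using P.integral_fst[of F] int S by (simp add: integral_uniform_count_measure)
qed

text \<open>A random sign paired with the output it acts on; under the uniform distribution on these
  pairs the two are independent.\<close>

abbreviation signed :: "'k set \<Rightarrow> (real \<times> 'k) set" where
  "signed K \<equiv> {-1, 1} \<times> K"

lemma sum_signed: "finite K \<Longrightarrow> (\<Sum>q\<in>signed K. g q) = (\<Sum>k\<in>K. g (-1, k) + g (1, k))"
  for g :: "real \<times> 'k \<Rightarrow> real"
  using sum.cartesian_product[of "\<lambda>e k. g (e, k)" K "{-1, 1}"] by (simp add: sum.distrib)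

text \<open>With maximizers \<open>t\<close> and \<open>t'\<close> of the two maxima, the left side
  is \<open>card K\<close> times \<open>A t + A t' + 2 * (l t - l t')\<close>. The Lipschitz bound
  splits the loss difference over the outputs, and each output also needs its own copy of
  \<open>A t + A t'\<close>. These copies account for the factor \<open>card K\<close> on the left,
  and hence for the same factor in front of \<open>f\<close> on the right.\<close>

lemma MAX_contraction:
  fixes l A :: "'t \<Rightarrow> real" and f :: "'t \<Rightarrow> 'k \<Rightarrow> real" and c :: real
  assumes T: "finite T" "T \<noteq> {}" and K: "finite K"
    and lip: "\<And>t t'. t \<in> T \<Longrightarrow> t' \<in> T \<Longrightarrow> \<bar>l t - l t'\<bar> \<le> c * (\<Sum>k\<in>K. \<bar>f t k - f t' k\<bar>)"
  shows "card K * ((MAX t\<in>T. A t + 2 * l t) + (MAX t\<in>T. A t - 2 * l t))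
      \<le> (\<Sum>(e, k)\<in>signed K. MAX t\<in>T. A t + 2 * card K * c * e * f t k)"
proof -
  define \<kappa> where "\<kappa> = real (card K)"
  define B where "B e k = (MAX t\<in>T. A t + 2 * \<kappa> * c * e * f t k)" for e k
  have "(MAX t\<in>T. A t + 2 * l t) \<in> (\<lambda>t. A t + 2 * l t) ` T"
    using T by (intro Max_in) auto
  then obtain t where t: "t \<in> T" "(MAX t\<in>T. A t + 2 * l t) = A t + 2 * l t" by auto
  have "(MAX t\<in>T. A t - 2 * l t) \<in> (\<lambda>t. A t - 2 * l t) ` T"
    using T by (intro Max_in) auto
  then obtain t' where t': "t' \<in> T" "(MAX t\<in>T. A t - 2 * l t) = A t' - 2 * l t'" by auto
  have B_ge: "A u + 2 * \<kappa> * c * e * f u k \<le> B e k" if "u \<in> T" for u e k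
    unfolding B_def using T that by (intro Max_ge) auto
  txt \<open>For each sign of the difference, one of the two pairings of \<open>t, t'\<close> with the signs works.\<close>
  have pair: "A t + A t' + 2 * \<kappa> * c * \<bar>f t k - f t' k\<bar> \<le> B (-1) k + B 1 k" for k
  proof (cases "f t' k \<le> f t k")
    case True
    then show ?thesis using B_ge[OF t(1), of 1 k] B_ge[OF t'(1), of "-1" k] by (simp add: algebra_simps)
  next
    case False
    then show ?thesis using B_ge[OF t(1), of "-1" k] B_ge[OF t'(1), of 1 k] by (simp add: algebra_simps)
  qed
  have "\<kappa> * ((A t + 2 * l t) + (A t' - 2 * l t')) \<le>
      \<kappa> * (A t + A t' + 2 * (c * (\<Sum>k\<in>K. \<bar>f t k - f t' k\<bar>)))"
    using lip[OF t(1) t'(1)] by (intro mult_left_mono) (auto simp: \<kappa>_def)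
  also have "\<dots> = (\<Sum>k\<in>K. A t + A t' + 2 * \<kappa> * c * \<bar>f t k - f t' k\<bar>)"
    by (simp add: sum.distrib sum_distrib_left \<kappa>_def algebra_simps)
  also have "\<dots> \<le> (\<Sum>k\<in>K. B (-1) k + B 1 k)" by (intro sum_mono pair)
  also have "\<dots> = (\<Sum>(e, k)\<in>signed K. B e k)" using sum_signed[OF K, of "\<lambda>(e, k). B e k"] by simp
  finally show ?thesis by (simp add: t t' B_def \<kappa>_def)
qed

text \<open>The comparison at a single sample point, for an arbitrary offset, in the form in which
  coordinates are exchanged. The 2 on the right arises from writing the deviation as the average of
  \<open>A t + 2 * (\<integral>z. l t z \<partial>D)\<close> and
  \<open>A t - 2 * l t z\<close>.\<close>

lemma expectation_MAX_symmetrization: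
  fixes l :: "'t \<Rightarrow> 'a \<Rightarrow> real" and f :: "'t \<Rightarrow> 'k \<Rightarrow> 'a \<Rightarrow> real" and c :: real
  assumes D: "prob_space D" and T: "finite T" "T \<noteq> {}" and K: "finite K" "K \<noteq> {}"
    and l: "\<And>t. t \<in> T \<Longrightarrow> integrable D (l t)"
    and f: "\<And>t k. t \<in> T \<Longrightarrow> k \<in> K \<Longrightarrow> integrable D (f t k)"
    and lip: "\<And>t t' z. t \<in> T \<Longrightarrow> t' \<in> T \<Longrightarrow> z \<in> space D \<Longrightarrow>
      \<bar>l t z - l t' z\<bar> \<le> c * (\<Sum>k\<in>K. \<bar>f t k z - f t' k z\<bar>)"
  shows "(\<integral>z. (MAX t\<in>T. A t + ((\<integral>z. l t z \<partial>D) - l t z)) \<partial>D) \<le>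
    (\<integral>\<zeta>. (MAX t\<in>T. A t + (case \<zeta> of ((e, k), z) \<Rightarrow> 2 * card K * c * e * f t k z))
       \<partial>(uniform_count_measure (signed K) \<Otimes>\<^sub>M D))"
proof -
  interpret D: prob_space D by fact
  define P where "P z = (MAX t\<in>T. A t + 2 * l t z)" for z
  define R where "R z = (MAX t\<in>T. A t - 2 * l t z)" for z
  define F where "F q z = (MAX t\<in>T. A t + 2 * card K * c * fst q * f t (snd q) z)" for q :: "real \<times> 'k" and z
  have P: "integrable D P" and R: "integrable D R"
    unfolding P_def R_def using T l
    by (intro integrable_MAX Bochner_Integration.integrable_add Bochner_Integration.integrable_diff; simp)+
  have F: "integrable D (F q)" if "q \<in> signed K" for q
    unfolding F_def using T f that
    by (intro integrable_MAX Bochner_Integration.integrable_add) auto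
  have card_signed: "card (signed K) = 2 * card K" by (simp add: card_cartesian_product)
  txt \<open>
    Splitting \<open>A t\<close> into two halves, one for the mean and one for the value of the loss, makes
    the usual ghost sample unnecessary.
  \<close>
  have "(\<integral>z. (MAX t\<in>T. A t + ((\<integral>z. l t z \<partial>D) - l t z)) \<partial>D) \<le> (\<integral>z. ((\<integral>z. P z \<partial>D) + R z) / 2 \<partial>D)"
  proof (rule integral_mono)
    show "integrable D (\<lambda>z. MAX t\<in>T. A t + ((\<integral>z. l t z \<partial>D) - l t z))"
      using T l
      by (intro integrable_MAX Bochner_Integration.integrable_add Bochner_Integration.integrable_diff; simp)
    show "integrable D (\<lambda>z. ((\<integral>z. P z \<partial>D) + R z) / 2)" using R by simp
    fix z
    show "(MAX t\<in>T. A t + ((\<integral>z. l t z \<partial>D) - l t z)) \<le> ((\<integral>z. P z \<partial>D) + R z) / 2"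
    proof (rule Max.boundedI)
      fix v assume "v \<in> (\<lambda>t. A t + ((\<integral>z. l t z \<partial>D) - l t z)) ` T"
      then obtain t where t: "t \<in> T" and v: "v = A t + ((\<integral>z. l t z \<partial>D) - l t z)" by auto
      have "A t + 2 * (\<integral>z. l t z \<partial>D) = (\<integral>z. A t + 2 * l t z \<partial>D)"
        using l[OF t] by (simp add: D.prob_space)
      also have "\<dots> \<le> (\<integral>z. P z \<partial>D)"
        using l[OF t] T t by (intro integral_mono P) (auto simp: P_def)
      finally have "A t + 2 * (\<integral>z. l t z \<partial>D) \<le> (\<integral>z. P z \<partial>D)" .
      moreover have "A t - 2 * l t z \<le> R z"
        unfolding R_def using T t by auto
      ultimately show "v \<le> ((\<integral>z. P z \<partial>D) + R z) / 2" by (simp add: v)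
    qed (use T in auto)
  qed
  also have "\<dots> = (\<integral>z. (P z + R z) / 2 \<partial>D)" using P R by (simp add: D.prob_space)
  \<comment> \<open>\<open>signed K\<close> has \<open>2 * card K\<close> elements: the 2 matches
    the average of \<open>P\<close> and \<open>R\<close>, and \<open>card K\<close> the factor on
    the left of the contraction.\<close>
  also have "\<dots> \<le> (\<integral>z. (\<Sum>q\<in>signed K. F q z) / card (signed K) \<partial>D)"
  proof (rule integral_mono)
    show "integrable D (\<lambda>z. (P z + R z) / 2)" using P R by simp
    show "integrable D (\<lambda>z. (\<Sum>q\<in>signed K. F q z) / card (signed K))"
      using F by (intro integrable_divide Bochner_Integration.integrable_sum)
    fix z assume "z \<in> space D"
    then have "card K * (P z + R z) \<le> (\<Sum>q\<in>signed K. F q z)"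
      using MAX_contraction[OF T K(1), of "\<lambda>t. l t z" c "\<lambda>t k. f t k z" A] lip
      by (simp add: P_def R_def F_def case_prod_unfold)
    moreover have "0 < real (card K)" using K by (simp add: card_gt_0_iff)
    ultimately show "(P z + R z) / 2 \<le> (\<Sum>q\<in>signed K. F q z) / card (signed K)"
      unfolding card_signed by (simp add: field_simps)
  qed
  also have "\<dots> = (\<Sum>q\<in>signed K. \<integral>z. F q z \<partial>D) / card (signed K)"
    using F by (simp only: integral_divide_zero Bochner_Integration.integral_sum)
  also have "\<dots> = (\<integral>(q, z). F q z \<partial>(uniform_count_measure (signed K) \<Otimes>\<^sub>M D))"
    by (rule integral_uniform_pair[OF D _ _ F, symmetric]) (use K in auto)
  finally show ?thesis by (simp add: F_def case_prod_unfold)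
qed

section \<open>Second moments and the linear process\<close>

lemma
  fixes v :: "'a \<Rightarrow> real" and I :: "'i set"
  assumes D: "prob_space D" and I: "finite I"
    and v: "integrable D v" "integrable D (\<lambda>z. (v z)\<^sup>2)" "(\<integral>z. v z \<partial>D) = 0"
  shows integrable_square_sum_PiM: "integrable (Pi\<^sub>M I (\<lambda>_. D)) (\<lambda>s. (\<Sum>i\<in>I. v (s i))\<^sup>2)"
    and integral_square_sum_PiM:
      "(\<integral>s. (\<Sum>i\<in>I. v (s i))\<^sup>2 \<partial>Pi\<^sub>M I (\<lambda>_. D)) = card I * (\<integral>z. (v z)\<^sup>2 \<partial>D)"
proof -
  interpret D: prob_space D by fact
  interpret P: product_prob_space "\<lambda>_. D" I by standard
  txt \<open>Writes \<open>v (s i) * v (s j)\<close> as a product over all of \<open>I\<close>, so that its integral factorizes.\<close>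
  define w where "w i j k z = (if k = i then v z else 1) * (if k = j then v z else 1)" for i j k :: 'i and z
  have prod_w: "(\<Prod>k\<in>I. w i j k (s k)) = v (s i) * v (s j)" if "i \<in> I" "j \<in> I" for i j s
    using that I by (simp add: w_def prod.distrib)
  have int_w: "integrable D (w i j k)" for i j k
    using v by (cases "k = i"; cases "k = j") (simp_all add: w_def[abs_def] power2_eq_square)
  have integral_w: "(\<integral>z. w i j k z \<partial>D) =
      (if k = i \<and> k = j then \<integral>z. (v z)\<^sup>2 \<partial>D else if k = i \<or> k = j then 0 else 1)" for i j k
    using v by (auto simp: w_def power2_eq_square D.prob_space)
  have int: "integrable (Pi\<^sub>M I (\<lambda>_. D)) (\<lambda>s. v (s i) * v (s j))" if "i \<in> I" "j \<in> I" for i j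
    using P.product_integrable_prod[where f = "w i j", OF I int_w] prod_w[OF that] by simp
  have integral: "(\<integral>s. v (s i) * v (s j) \<partial>Pi\<^sub>M I (\<lambda>_. D)) = (if i = j then \<integral>z. (v z)\<^sup>2 \<partial>D else 0)"
    if ij: "i \<in> I" "j \<in> I" for i j
  proof -
    have "(\<integral>s. v (s i) * v (s j) \<partial>Pi\<^sub>M I (\<lambda>_. D)) = (\<Prod>k\<in>I. \<integral>z. w i j k z \<partial>D)"
      using P.product_integral_prod[where f = "w i j", OF I int_w] prod_w[OF ij] by simp
    also have "\<dots> = (if i = j then \<integral>z. (v z)\<^sup>2 \<partial>D else 0)"
    proof (cases "i = j")
      case True
      then have "(\<Prod>k\<in>I. \<integral>z. w i j k z \<partial>D) = (\<Prod>k\<in>I. if k = j then \<integral>z. (v z)\<^sup>2 \<partial>D else 1)"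
        by (intro prod.cong) (auto simp: integral_w)
      then show ?thesis using I ij True by simp
    next
      case False
      then show ?thesis using I ij by (auto simp: integral_w intro!: bexI[of _ i])
    qed
    finally show ?thesis .
  qed
  have sq: "(\<Sum>i\<in>I. v (s i))\<^sup>2 = (\<Sum>i\<in>I. \<Sum>j\<in>I. v (s i) * v (s j))" for s
    by (simp add: power2_eq_square sum_product)
  show "integrable (Pi\<^sub>M I (\<lambda>_. D)) (\<lambda>s. (\<Sum>i\<in>I. v (s i))\<^sup>2)"
    unfolding sq using int by (intro Bochner_Integration.integrable_sum)
  have "(\<integral>s. (\<Sum>i\<in>I. v (s i))\<^sup>2 \<partial>Pi\<^sub>M I (\<lambda>_. D)) =
      (\<Sum>i\<in>I. \<Sum>j\<in>I. \<integral>s. v (s i) * v (s j) \<partial>Pi\<^sub>M I (\<lambda>_. D))"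
    unfolding sq using int by (subst Bochner_Integration.integral_sum)
      (auto intro!: Bochner_Integration.integrable_sum sum.cong Bochner_Integration.integral_sum)
  also have "\<dots> = (\<Sum>i\<in>I. \<integral>z. (v z)\<^sup>2 \<partial>D)"
    using I by (intro sum.cong) (simp_all add: integral)
  finally show "(\<integral>s. (\<Sum>i\<in>I. v (s i))\<^sup>2 \<partial>Pi\<^sub>M I (\<lambda>_. D)) = card I * (\<integral>z. (v z)\<^sup>2 \<partial>D)" by simp
qed

text \<open>Jensen's inequality for the square, read off from the nonnegativity of the
  variance.\<close>

lemma (in prob_space) expectation_le_sqrt:
  fixes X :: "'a \<Rightarrow> real"
  assumes "integrable M X" "integrable M (\<lambda>x. (X x)\<^sup>2)"
  shows "expectation X \<le> sqrt (expectation (\<lambda>x. (X x)\<^sup>2))"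
  using variance_eq[OF assms] variance_positive[of X] by (intro real_le_rsqrt) simp

text \<open>Regrouping the sample by drawn output turns the process into a sum over \<open>k\<close>
  of inner products of \<open>w t k\<close> with a random vector \<open>V k\<close> indexed by
  \<open>J\<close>. Cauchy-Schwarz replaces \<open>w t k\<close> by its norm bound, which removes
  the maximum over \<open>t\<close>. The expected norm of \<open>V k\<close> is at most the root of
  its second moment, and that moment grows linearly in the sample size because the signs center the
  summands.\<close>

lemma expectation_MAX_linear_le:
  fixes \<phi> :: "'p \<Rightarrow> 'a \<Rightarrow> real" and w :: "'t \<Rightarrow> 'k \<Rightarrow> 'p \<Rightarrow> real" and I :: "'i set"
    and c C\<^sub>\<sigma> C\<^sub>w :: real
  assumes D: "prob_space D" and T: "finite T" "T \<noteq> {}" and K: "finite K" "K \<noteq> {}" and I: "finite I"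
    and J: "finite J" and c: "0 \<le> c" and C\<^sub>w: "0 \<le> C\<^sub>w" and C\<^sub>\<sigma>: "0 \<le> C\<^sub>\<sigma>"
    and \<phi>: "\<And>p. p \<in> J \<Longrightarrow> integrable D (\<phi> p)" "\<And>p. p \<in> J \<Longrightarrow> integrable D (\<lambda>z. (\<phi> p z)\<^sup>2)"
    and norm_\<phi>: "(\<Sum>p\<in>J. \<integral>z. (\<phi> p z)\<^sup>2 \<partial>D) \<le> C\<^sub>\<sigma>\<^sup>2"
    and norm_w: "\<And>t k. t \<in> T \<Longrightarrow> k \<in> K \<Longrightarrow> L2_set (w t k) J \<le> C\<^sub>w"
  shows "(\<integral>s. (MAX t\<in>T. \<Sum>i\<in>I. case s i of ((e, k), z) \<Rightarrow> 2 * card K * c * e * (\<Sum>p\<in>J. \<phi> p z * w t k p))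
       \<partial>Pi\<^sub>M I (\<lambda>_. uniform_count_measure (signed K) \<Otimes>\<^sub>M D))
     \<le> 2 * (card K)\<^sup>2 * c * C\<^sub>\<sigma> * C\<^sub>w * sqrt (card I)"
proof -
  interpret D: prob_space D by fact
  define D' where "D' = uniform_count_measure (signed K) \<Otimes>\<^sub>M D"
  interpret Q: prob_space "uniform_count_measure (signed K)"
    using K by (intro prob_space_uniform_count_measure) auto
  interpret QD: pair_prob_space "uniform_count_measure (signed K)" D ..
  have D': "prob_space D'" unfolding D'_def by (rule QD.prob_space_axioms)
  let ?P = "Pi\<^sub>M I (\<lambda>_. D')"
  interpret P: prob_space ?P using D' by (intro prob_space_PiM)
  define \<kappa> where "\<kappa> = real (card K)"
  have \<kappa>: "0 < \<kappa>" using K by (simp add: \<kappa>_def card_gt_0_iff)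
  \<comment> \<open>The sign if output \<open>k\<close> was drawn and 0 otherwise: the coordinate
    \<open>k\<close> of the random pair.\<close>
  define b where "b k q = (if snd q = k then fst q else 0)" for k :: 'k and q :: "real \<times> 'k"
  define v where "v k p = (\<lambda>(q, z). b k q * \<phi> p z)" for k p
  define V where "V k p s = (\<Sum>i\<in>I. v k p (s i))" for k p and s :: "'i \<Rightarrow> (real \<times> 'k) \<times> 'a"
  have signed: "finite (signed K)" "signed K \<noteq> {}" using K by auto
  have card_signed: "real (card (signed K)) = 2 * \<kappa>" by (simp add: \<kappa>_def card_cartesian_product)
  have v_int: "integrable D' (v k p)" if "p \<in> J" for k p
    unfolding D'_def v_def using \<phi>(1)[OF that] by (intro integrable_uniform_pair D signed) simp
  have v_sq: "(v k p \<zeta>)\<^sup>2 = (\<lambda>(q, z). (b k q)\<^sup>2 * (\<phi> p z)\<^sup>2) \<zeta>" for k p \<zeta>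
    by (simp add: v_def case_prod_unfold power_mult_distrib)
  have v_sq_int: "integrable D' (\<lambda>\<zeta>. (v k p \<zeta>)\<^sup>2)" if "p \<in> J" for k p
    unfolding v_sq D'_def using \<phi>(2)[OF that] by (intro integrable_uniform_pair D signed) simp
  have v_mean: "(\<integral>\<zeta>. v k p \<zeta> \<partial>D') = 0" if "p \<in> J" for k p
  proof -
    have "(\<integral>\<zeta>. v k p \<zeta> \<partial>D') = (\<Sum>q\<in>signed K. \<integral>z. b k q * \<phi> p z \<partial>D) / card (signed K)"
      unfolding D'_def v_def using \<phi>(1)[OF that] by (intro integral_uniform_pair D signed) simp
    also have "\<dots> = 0" using K by (subst sum_signed) (auto simp: b_def intro!: sum.neutral split: if_splits)
    finally show ?thesis .
  qed
  have v_var: "(\<integral>\<zeta>. (v k p \<zeta>)\<^sup>2 \<partial>D') \<le> (\<integral>z. (\<phi> p z)\<^sup>2 \<partial>D)" if "p \<in> J" for k p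
  proof -
    have "(\<integral>\<zeta>. (v k p \<zeta>)\<^sup>2 \<partial>D') =
        (\<Sum>q\<in>signed K. \<integral>z. (b k q)\<^sup>2 * (\<phi> p z)\<^sup>2 \<partial>D) / card (signed K)"
      unfolding D'_def v_sq using \<phi>(2)[OF that] by (intro integral_uniform_pair D signed) simp
    also have "\<dots> \<le> (\<Sum>q\<in>signed K. \<integral>z. (\<phi> p z)\<^sup>2 \<partial>D) / card (signed K)"
    proof (intro divide_right_mono sum_mono)
      fix q assume "q \<in> signed K"
      \<comment> \<open>The mean of this square is only \<open>1 / card K\<close>, the probability
        that \<open>k\<close> is drawn. The bound by 1 leads to the square of \<open>card K\<close>
        in the result in place of the power 3/2.\<close>
      then have "(b k q)\<^sup>2 \<le> 1" by (auto simp: b_def)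
      then have "(b k q)\<^sup>2 * (\<integral>z. (\<phi> p z)\<^sup>2 \<partial>D) \<le> 1 * (\<integral>z. (\<phi> p z)\<^sup>2 \<partial>D)"
        by (intro mult_right_mono) auto
      then show "(\<integral>z. (b k q)\<^sup>2 * (\<phi> p z)\<^sup>2 \<partial>D) \<le> (\<integral>z. (\<phi> p z)\<^sup>2 \<partial>D)" by simp
    qed simp
    also have "\<dots> = (\<integral>z. (\<phi> p z)\<^sup>2 \<partial>D)" using card_signed \<kappa> by (simp add: card_cartesian_product)
    finally show ?thesis .
  qed
  have V_int: "integrable ?P (V k p)" if "p \<in> J" for k p
    unfolding V_def using D' I v_int[OF that] by (rule integrable_sum_PiM)
  have V_sq_int: "integrable ?P (\<lambda>s. (V k p s)\<^sup>2)" if "p \<in> J" for k p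
    unfolding V_def
    using D' I v_int[OF that] v_sq_int[OF that] v_mean[OF that] by (rule integrable_square_sum_PiM)
  have norm_V_int: "integrable ?P (\<lambda>s. L2_set (\<lambda>p. V k p s) J)" for k
  proof (rule Bochner_Integration.integrable_bound)
    show "integrable ?P (\<lambda>s. \<Sum>p\<in>J. \<bar>V k p s\<bar>)"
      using V_int by (intro Bochner_Integration.integrable_sum integrable_abs)
    have "(\<lambda>s. V k p s) \<in> borel_measurable ?P" if "p \<in> J" for p
      using V_int[OF that] by simp
    then show "(\<lambda>s. L2_set (\<lambda>p. V k p s) J) \<in> borel_measurable ?P"
      unfolding L2_set_def
      by (intro measurable_compose[OF _ borel_measurable_sqrt] borel_measurable_sum borel_measurable_power)
    show "AE s in ?P. norm (L2_set (\<lambda>p. V k p s) J) \<le> norm (\<Sum>p\<in>J. \<bar>V k p s\<bar>)"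
      by (intro AE_I2) (simp add: L2_set_le_sum_abs abs_of_nonneg sum_nonneg)
  qed
  have norm_V: "(\<integral>s. L2_set (\<lambda>p. V k p s) J \<partial>?P) \<le> C\<^sub>\<sigma> * sqrt (card I)" for k
  proof -
    have sq: "(L2_set (\<lambda>p. V k p s) J)\<^sup>2 = (\<Sum>p\<in>J. (V k p s)\<^sup>2)" for s
      by (simp add: L2_set_def sum_nonneg)
    have "(\<integral>s. L2_set (\<lambda>p. V k p s) J \<partial>?P) \<le> sqrt (\<integral>s. (L2_set (\<lambda>p. V k p s) J)\<^sup>2 \<partial>?P)"
    proof (rule P.expectation_le_sqrt[OF norm_V_int])
      show "integrable ?P (\<lambda>s. (L2_set (\<lambda>p. V k p s) J)\<^sup>2)"
        unfolding sq using V_sq_int by (intro Bochner_Integration.integrable_sum)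
    qed
    also have "(\<integral>s. (L2_set (\<lambda>p. V k p s) J)\<^sup>2 \<partial>?P) = (\<Sum>p\<in>J. \<integral>s. (V k p s)\<^sup>2 \<partial>?P)"
      unfolding sq using V_sq_int by (rule Bochner_Integration.integral_sum)
    also have "\<dots> = (\<Sum>p\<in>J. card I * (\<integral>\<zeta>. (v k p \<zeta>)\<^sup>2 \<partial>D'))"
      unfolding V_def using D' I v_int v_sq_int v_mean
      by (intro sum.cong refl integral_square_sum_PiM)
    also have "\<dots> \<le> (\<Sum>p\<in>J. card I * (\<integral>z. (\<phi> p z)\<^sup>2 \<partial>D))"
      by (intro sum_mono mult_left_mono v_var) auto
    also have "\<dots> \<le> card I * C\<^sub>\<sigma>\<^sup>2"
      unfolding sum_distrib_left[symmetric] by (intro mult_left_mono norm_\<phi>) auto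
    also have "sqrt (card I * C\<^sub>\<sigma>\<^sup>2) = C\<^sub>\<sigma> * sqrt (card I)"
      using C\<^sub>\<sigma> by (simp add: real_sqrt_mult)
    finally show ?thesis by simp
  qed
  define h where "h t = (\<lambda>((e, k), z). 2 * \<kappa> * c * e * (\<Sum>p\<in>J. \<phi> p z * w t k p))" for t
  have h_int: "integrable D' (h t)" for t
  proof -
    have "integrable D' (\<lambda>(q, z). 2 * \<kappa> * c * fst q * (\<Sum>p\<in>J. \<phi> p z * w t (snd q) p))"
      unfolding D'_def using \<phi>(1) by (intro integrable_uniform_pair D signed) auto
    then show ?thesis by (simp add: h_def case_prod_unfold)
  qed
  have "(\<integral>s. (MAX t\<in>T. \<Sum>i\<in>I. h t (s i)) \<partial>?P) \<le>
      (\<integral>s. (\<Sum>k\<in>K. 2 * \<kappa> * c * C\<^sub>w * L2_set (\<lambda>p. V k p s) J) \<partial>?P)"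
  proof (rule integral_mono)
    show "integrable ?P (\<lambda>s. MAX t\<in>T. \<Sum>i\<in>I. h t (s i))"
      using T I by (intro integrable_MAX integrable_sum_PiM D' h_int)
    show "integrable ?P (\<lambda>s. \<Sum>k\<in>K. 2 * \<kappa> * c * C\<^sub>w * L2_set (\<lambda>p. V k p s) J)"
      using norm_V_int by simp
    fix s assume s: "s \<in> space ?P"
    \<comment> \<open>Ensures that the drawn output is among the terms of the sum over
      \<open>K\<close> in \<open>h_eq\<close>, where it is the only one that survives.\<close>
    have snd_s: "snd (fst (s i)) \<in> K" if "i \<in> I" for i
    proof -
      have "s i \<in> space D'" using s that by (auto simp: space_PiM)
      then show ?thesis by (auto simp: D'_def space_pair_measure space_uniform_count_measure)
    qed
    show "(MAX t\<in>T. \<Sum>i\<in>I. h t (s i)) \<le> (\<Sum>k\<in>K. 2 * \<kappa> * c * C\<^sub>w * L2_set (\<lambda>p. V k p s) J)"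
    proof (rule Max.boundedI)
      fix x assume "x \<in> (\<lambda>t. \<Sum>i\<in>I. h t (s i)) ` T"
      then obtain t where t: "t \<in> T" and x: "x = (\<Sum>i\<in>I. h t (s i))" by auto
      have h_eq: "h t (s i) = (\<Sum>k\<in>K. 2 * \<kappa> * c * (\<Sum>p\<in>J. v k p (s i) * w t k p))" if i: "i \<in> I" for i
      proof -
        obtain e k z where si: "s i = ((e, k), z)" by (metis prod.collapse)
        then have k: "k \<in> K" using snd_s[OF i] by simp
        have "(\<Sum>k'\<in>K. 2 * \<kappa> * c * (\<Sum>p\<in>J. v k' p (s i) * w t k' p)) =
            (\<Sum>k'\<in>K. if k' = k then 2 * \<kappa> * c * (\<Sum>p\<in>J. v k p (s i) * w t k p) else 0)"
          by (intro sum.cong) (auto simp: v_def b_def si)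
        also have "\<dots> = 2 * \<kappa> * c * (\<Sum>p\<in>J. e * \<phi> p z * w t k p)"
          using K k by (simp add: v_def b_def si)
        also have "\<dots> = h t (s i)"
          by (simp add: h_def si sum_distrib_left mult_ac)
        finally show ?thesis ..
      qed
      have "x = (\<Sum>k\<in>K. \<Sum>i\<in>I. 2 * \<kappa> * c * (\<Sum>p\<in>J. v k p (s i) * w t k p))"
        unfolding x using h_eq by (subst sum.swap) simp
      also have "\<dots> = (\<Sum>k\<in>K. 2 * \<kappa> * c * (\<Sum>p\<in>J. V k p s * w t k p))"
        unfolding V_def sum_distrib_right sum_distrib_left by (intro sum.cong refl sum.swap)
      also have "\<dots> \<le> (\<Sum>k\<in>K. 2 * \<kappa> * c * (C\<^sub>w * L2_set (\<lambda>p. V k p s) J))"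
      proof (intro sum_mono mult_left_mono)
        fix k assume k: "k \<in> K"
        have "(\<Sum>p\<in>J. V k p s * w t k p) \<le> (\<Sum>p\<in>J. \<bar>V k p s\<bar> * \<bar>w t k p\<bar>)"
          by (intro sum_mono) (simp add: abs_mult[symmetric])
        also have "\<dots> \<le> L2_set (\<lambda>p. V k p s) J * L2_set (w t k) J"
          by (rule L2_set_mult_ineq)
        also have "\<dots> \<le> L2_set (\<lambda>p. V k p s) J * C\<^sub>w"
          by (intro mult_left_mono norm_w t k) auto
        finally show "(\<Sum>p\<in>J. V k p s * w t k p) \<le> C\<^sub>w * L2_set (\<lambda>p. V k p s) J"
          by (simp add: mult.commute)
      qed (use \<kappa> c in auto)
      finally show "x \<le> (\<Sum>k\<in>K. 2 * \<kappa> * c * C\<^sub>w * L2_set (\<lambda>p. V k p s) J)"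
        by (simp add: mult.assoc)
    qed (use T in auto)
  qed
  also have "\<dots> = (\<Sum>k\<in>K. 2 * \<kappa> * c * C\<^sub>w * (\<integral>s. L2_set (\<lambda>p. V k p s) J \<partial>?P))"
    using norm_V_int by simp
  also have "\<dots> \<le> (\<Sum>k\<in>K. 2 * \<kappa> * c * C\<^sub>w * (C\<^sub>\<sigma> * sqrt (card I)))"
    using \<kappa> c C\<^sub>w by (intro sum_mono mult_left_mono norm_V) auto
  also have "\<dots> = 2 * (card K)\<^sup>2 * c * C\<^sub>\<sigma> * C\<^sub>w * sqrt (card I)"
    by (simp add: \<kappa>_def power2_eq_square)
  finally show ?thesis by (simp add: h_def D'_def \<kappa>_def case_prod_unfold)
qed

section \<open>Uniform deviations of Lipschitz losses\<close>

text \<open>What the argument uses of a network with frozen masks: outputs are linear in the path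
  weights over fixed features. Models are represented by indices \<open>t\<close>, since density and
  limits are taken in the parameters \<open>w\<close> and not in the functions they define.\<close>

locale Lipschitz_loss_class = prob_space D
  for D :: "'a measure" +
  fixes \<F> :: "'t set" and l :: "'t \<Rightarrow> 'a \<Rightarrow> real"
    and K :: "'k set" and J :: "'p set" and \<phi> :: "'p \<Rightarrow> 'a \<Rightarrow> real" and w :: "'t \<Rightarrow> 'k \<Rightarrow> 'p \<Rightarrow> real"
    and c C\<^sub>\<sigma> C\<^sub>w :: real
  assumes K: "finite K" "K \<noteq> {}" and J: "finite J" and c: "0 \<le> c" and C\<^sub>\<sigma>: "0 \<le> C\<^sub>\<sigma>"
    and \<phi>_integrable: "p \<in> J \<Longrightarrow> integrable D (\<phi> p)" "p \<in> J \<Longrightarrow> integrable D (\<lambda>z. (\<phi> p z)\<^sup>2)"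
    and norm_\<phi>: "(\<Sum>p\<in>J. \<integral>z. (\<phi> p z)\<^sup>2 \<partial>D) \<le> C\<^sub>\<sigma>\<^sup>2"
    and norm_w: "t \<in> \<F> \<Longrightarrow> k \<in> K \<Longrightarrow> L2_set (w t k) J \<le> C\<^sub>w"
    and l_measurable: "t \<in> \<F> \<Longrightarrow> l t \<in> borel_measurable D"
    and l_range: "t \<in> \<F> \<Longrightarrow> z \<in> space D \<Longrightarrow> l t z \<in> {0..1}"
    and l_Lipschitz: "t \<in> \<F> \<Longrightarrow> t' \<in> \<F> \<Longrightarrow> z \<in> space D \<Longrightarrow>
      \<bar>l t z - l t' z\<bar> \<le> c * (\<Sum>k\<in>K. \<bar>(\<Sum>p\<in>J. \<phi> p z * w t k p) - (\<Sum>p\<in>J. \<phi> p z * w t' k p)\<bar>)"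
begin

definition empirical_bound :: "'i set \<Rightarrow> real \<Rightarrow> ('i \<Rightarrow> 'a) \<Rightarrow> 't \<Rightarrow> real" where
  "empirical_bound I \<delta> s t = (\<Sum>i\<in>I. l t (s i)) / card I
     + 2 * (card K)\<^sup>2 * c * C\<^sub>\<sigma> * C\<^sub>w / sqrt (card I) + sqrt (ln (1 / \<delta>) / (2 * card I))"

text \<open>Taken relative to a set \<open>T\<close> of models, so that one notion covers finite
  \<open>T\<close>, where a maximum can be formed, and countable \<open>T\<close>, where the event
  is still measurable.\<close>

definition good_samples :: "'i set \<Rightarrow> real \<Rightarrow> 't set \<Rightarrow> ('i \<Rightarrow> 'a) set" where
  "good_samples I \<delta> T = {s \<in> space (Pi\<^sub>M I (\<lambda>_. D)). \<forall>t\<in>T. (\<integral>z. l t z \<partial>D) \<le> empirical_bound I \<delta> s t}"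

lemma integrable_l: "t \<in> \<F> \<Longrightarrow> integrable D (l t)"
  by (rule integrable_const_bound[of _ 1]) (use l_measurable l_range in auto)

lemma good_samples_measurable:
  assumes T: "finite T" "T \<subseteq> \<F>"
  shows "good_samples I \<delta> T \<in> sets (Pi\<^sub>M I (\<lambda>_. D))"
proof -
  have "(\<lambda>s. l t (s i)) \<in> borel_measurable (Pi\<^sub>M I (\<lambda>_. D))" if "t \<in> T" "i \<in> I" for t i
    using measurable_component_singleton[OF that(2), of "\<lambda>_. D"] l_measurable[of t] T that(1)
    by (auto intro: measurable_compose)
  then have "(\<lambda>s. \<Sum>i\<in>I. l t (s i)) \<in> borel_measurable (Pi\<^sub>M I (\<lambda>_. D))" if "t \<in> T" for t
    using that by (intro borel_measurable_sum)
  then show ?thesis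
    unfolding good_samples_def empirical_bound_def using T
    by (intro sets.sets_Collect_finite_All borel_measurable_le
      borel_measurable_add borel_measurable_divide borel_measurable_const) auto
qed

text \<open>McDiarmid is applied to \<open>\<Phi>\<close>, the largest deviation without the
  division by the sample size, for which changing one point costs at most 1. Its mean is bounded by
  exchanging all points for signed ones and then estimating the linear process.\<close>

lemma measure_good_samples_finite:
  assumes T: "finite T" "T \<subseteq> \<F>" and I: "finite I" "I \<noteq> {}" and \<delta>: "0 < \<delta>" "\<delta> < 1"
  shows "1 - \<delta> \<le> measure (Pi\<^sub>M I (\<lambda>_. D)) (good_samples I \<delta> T)"
proof -
  let ?P = "Pi\<^sub>M I (\<lambda>_. D)"
  note D = prob_space_axioms
  interpret P: prob_space ?P using D by (intro prob_space_PiM)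
  define G where "G = good_samples I \<delta> T"
  have G: "G \<in> sets ?P" unfolding G_def using T by (rule good_samples_measurable)
  have "1 - \<delta> \<le> measure ?P G"
  \<comment> \<open>An empty \<open>T\<close> is set apart: \<open>Max\<close> needs an argument,
    and a member of \<open>T\<close> is what shows \<open>0 \<le> C\<^sub>w\<close>.\<close>
  proof (cases "T = {}")
    case True
    then have "G = space ?P" by (auto simp: G_def good_samples_def)
    then show ?thesis using \<delta> by (simp add: P.prob_space)
  next
    case False
    define N where "N = real (card I)"
    have N: "0 < N" using I by (simp add: N_def card_gt_0_iff)
    obtain t\<^sub>0 k\<^sub>0 where "t\<^sub>0 \<in> T" "k\<^sub>0 \<in> K" using False K by auto
    then have C\<^sub>w: "0 \<le> C\<^sub>w" 
      using T norm_w[of t\<^sub>0 k\<^sub>0] L2_set_nonneg[of "w t\<^sub>0 k\<^sub>0" J] by (meson order_trans subsetD)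
    have l_int: "integrable D (l t)" if "t \<in> T" for t
      using integrable_l T that by auto
    have l: "l t z \<in> {0..1}" if "t \<in> T" "z \<in> space D" for t z
      using l_range T that by auto
    define u where "u t z = (\<integral>z. l t z \<partial>D) - l t z" for t z
    have u_int: "integrable D (u t)" if "t \<in> T" for t
      unfolding u_def using l_int[OF that] by simp
    define \<Phi> where "\<Phi> s = (MAX t\<in>T. \<Sum>i\<in>I. u t (s i))" for s
    \<comment> \<open>Solves \<open>exp (- 2 * \<epsilon>\<^sup>2 / N) = \<delta>\<close>; divided
      by \<open>N\<close> it becomes the confidence term.\<close>
    define \<epsilon> where "\<epsilon> = sqrt (N * ln (1 / \<delta>) / 2)"
    have \<epsilon>: "0 < \<epsilon>" using N \<delta> by (simp add: \<epsilon>_def)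
    have El: "(\<integral>z. l t z \<partial>D) \<in> {0..1}" if t: "t \<in> T" for t
    proof -
      have "(\<integral>z. l t z \<partial>D) \<le> (\<integral>z. 1 \<partial>D)"
        using l_int[OF t] l[OF t] by (intro integral_mono) auto
      moreover have "0 \<le> (\<integral>z. l t z \<partial>D)"
        using l[OF t] by (intro integral_nonneg_AE AE_I2) auto
      ultimately show ?thesis by (simp add: prob_space)
    qed
    have u_meas: "u t \<in> borel_measurable D" if "t \<in> T" for t
      using u_int[OF that] by simp
    have comp: "s i \<in> space D" if "s \<in> space ?P" "i \<in> I" for s i
      using that by (auto simp: space_PiM)
    have \<Phi>_meas: "\<Phi> \<in> borel_measurable ?P"
    proof -
      have "(\<lambda>s. u t (s i)) \<in> borel_measurable ?P" if "t \<in> T" "i \<in> I" for t i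
        using u_meas[OF that(1)] that(2) by measurable
      then show ?thesis
        unfolding \<Phi>_def using T by (intro borel_measurable_Max borel_measurable_sum)
    qed
    have \<Phi>_ge: "(\<Sum>i\<in>I. u t (s i)) \<le> \<Phi> s" if "t \<in> T" for s t
      unfolding \<Phi>_def using T that by (intro Max_ge) auto
    have \<Phi>_le: "\<Phi> s \<le> x" if "\<And>t. t \<in> T \<Longrightarrow> (\<Sum>i\<in>I. u t (s i)) \<le> x" for s x
      unfolding \<Phi>_def using T False that by (intro Max.boundedI) auto
    have \<Phi>_bounded: "\<bar>\<Phi> s\<bar> \<le> N" if s: "s \<in> space ?P" for s
    proof -
      have "\<bar>\<Sum>i\<in>I. u t (s i)\<bar> \<le> N" if t: "t \<in> T" for t
      proof -
        have "\<bar>\<Sum>i\<in>I. u t (s i)\<bar> \<le> (\<Sum>i\<in>I. \<bar>u t (s i)\<bar>)" by (rule sum_abs)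
        also have "\<dots> \<le> (\<Sum>i\<in>I. 1)"
        proof (rule sum_mono)
          fix i assume "i \<in> I"
          then show "\<bar>u t (s i)\<bar> \<le> 1"
            using l[OF t comp[OF s]] El[OF t] by (force simp: u_def abs_le_iff)
        qed
        finally show ?thesis by (simp add: N_def)
      qed
      then have bound: "\<And>t. t \<in> T \<Longrightarrow> \<bar>\<Sum>i\<in>I. u t (s i)\<bar> \<le> N" .
      have "\<Phi> s \<le> N" using bound by (intro \<Phi>_le) (force simp: abs_le_iff)
      moreover have "- N \<le> \<Phi> s"
        using bound[OF \<open>t\<^sub>0 \<in> T\<close>] \<Phi>_ge[OF \<open>t\<^sub>0 \<in> T\<close>, of s] by linarith
      ultimately show ?thesis by simp
    qed
    have \<Phi>_step: "\<Phi> (s(i := z)) \<le> \<Phi> s + 1"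
      if "s i \<in> space D" "i \<in> I" "z \<in> space D" for s i z
    proof (rule \<Phi>_le)
      fix t assume t: "t \<in> T"
      have "(\<Sum>j\<in>I. u t ((s(i := z)) j)) = u t z + (\<Sum>j\<in>I - {i}. u t (s j))"
        using I that by (subst sum.remove[of _ i]) (auto intro!: sum.cong)
      moreover have "(\<Sum>j\<in>I. u t (s j)) = u t (s i) + (\<Sum>j\<in>I - {i}. u t (s j))"
        using I that by (subst sum.remove[of _ i]) auto
      \<comment> \<open>The mean of \<open>l t\<close> cancels in the difference, so the cost is the
        length 1 of the range of the loss, not the length 2 of [-1,1].\<close>
      moreover have "u t z \<le> u t (s i) + 1"
        using l[OF t that(1)] l[OF t that(3)] by (simp add: u_def)
      ultimately show "(\<Sum>j\<in>I. u t ((s(i := z)) j)) \<le> \<Phi> s + 1"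
        using \<Phi>_ge[OF t, of s] by simp
    qed
    \<comment> \<open>The opposite inequality is \<open>\<Phi>_step\<close> for the altered sample,
      with the old value put back.\<close>
    have \<Phi>_diff: "\<bar>\<Phi> (s(i := z)) - \<Phi> s\<bar> \<le> 1"
      if s: "s \<in> space ?P" and i: "i \<in> I" and z: "z \<in> space D" for s i z
      using \<Phi>_step[of s i z] \<Phi>_step[of "s(i := z)" i "s i"] comp[OF s i] i z by simp
    have "(\<integral>s. \<Phi> s \<partial>?P) \<le>
        (\<integral>s. (MAX t\<in>T. \<Sum>i\<in>I. case s i of ((e, k), z) \<Rightarrow> 2 * card K * c * e * (\<Sum>p\<in>J. \<phi> p z * w t k p))
           \<partial>Pi\<^sub>M I (\<lambda>_. uniform_count_measure (signed K) \<Otimes>\<^sub>M D))" (is "_ \<le> ?R")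
    proof -
      define h where "h t = (\<lambda>((e :: real, k), z). 2 * card K * c * e * (\<Sum>p\<in>J. \<phi> p z * w t k p))" for t
      interpret Q: prob_space "uniform_count_measure (signed K)"
        using K by (intro prob_space_uniform_count_measure) auto
      interpret QD: pair_prob_space "uniform_count_measure (signed K)" D ..
      have "integrable (uniform_count_measure (signed K) \<Otimes>\<^sub>M D)
          (\<lambda>(q, z). 2 * card K * c * fst q * (\<Sum>p\<in>J. \<phi> p z * w t (snd q) p))" for t
        using \<phi>_integrable(1) K by (intro integrable_uniform_pair D) auto
      then have h_int: "integrable (uniform_count_measure (signed K) \<Otimes>\<^sub>M D) (h t)" for t
        by (simp add: h_def case_prod_unfold)
      have f_int: "integrable D (\<lambda>z. \<Sum>p\<in>J. \<phi> p z * w t k p)" for t k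
        using \<phi>_integrable(1) by auto
      have "(\<integral>s. (MAX t\<in>T. 0 + (\<Sum>i\<in>I. u t (s i))) \<partial>Pi\<^sub>M I (\<lambda>_. D)) \<le>
        (\<integral>s. (MAX t\<in>T. 0 + (\<Sum>i\<in>I. h t (s i))) \<partial>Pi\<^sub>M I (\<lambda>_. uniform_count_measure (signed K) \<Otimes>\<^sub>M D))"
      proof (rule expectation_MAX_sum_le[OF D QD.prob_space_axioms T(1) False I(1) u_int h_int])
        fix A
        show "(\<integral>z. (MAX t\<in>T. A t + u t z) \<partial>D) \<le>
            (\<integral>\<zeta>. (MAX t\<in>T. A t + h t \<zeta>) \<partial>(uniform_count_measure (signed K) \<Otimes>\<^sub>M D))"
          unfolding u_def h_def
          using expectation_MAX_symmetrization[of D T K l "\<lambda>t k z. \<Sum>p\<in>J. \<phi> p z * w t k p" c A]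
            D T(1) False K l_int f_int l_Lipschitz[OF subsetD[OF T(2)] subsetD[OF T(2)]] by (simp add: case_prod_unfold)
      qed
      then show ?thesis by (simp add: \<Phi>_def h_def case_prod_unfold)
    qed
    also have "?R \<le> 2 * (card K)\<^sup>2 * c * C\<^sub>\<sigma> * C\<^sub>w * sqrt (card I)"
      using norm_w[OF subsetD[OF T(2)]] by (intro expectation_MAX_linear_le D T(1) False K I J c C\<^sub>w C\<^sub>\<sigma> \<phi>_integrable norm_\<phi>)
    finally have E\<Phi>: "(\<integral>s. \<Phi> s \<partial>?P) \<le> 2 * (card K)\<^sup>2 * c * C\<^sub>\<sigma> * C\<^sub>w * sqrt N"
      by (simp add: N_def)
    define B where "B = {s \<in> space ?P. (\<integral>s. \<Phi> s \<partial>?P) + \<epsilon> \<le> \<Phi> s}"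
    have B: "B \<in> sets ?P" unfolding B_def using \<Phi>_meas by measurable
    have "measure ?P B \<le> exp (- 2 * \<epsilon>\<^sup>2 / (real (card I) * 1\<^sup>2))"
      unfolding B_def by (rule McDiarmid_ineq[OF D I zero_less_one \<Phi>_meas \<Phi>_bounded \<Phi>_diff \<epsilon>])
    also have "\<epsilon>\<^sup>2 = N * ln (1 / \<delta>) / 2"
      unfolding \<epsilon>_def using N \<delta> by (intro real_sqrt_pow2) simp
    also have "- 2 * (N * ln (1 / \<delta>) / 2) / (real (card I) * 1\<^sup>2) = ln \<delta>"
      using N \<delta> by (simp add: N_def ln_div)
    finally have "measure ?P B \<le> \<delta>" using \<delta> by simp
    then have "1 - \<delta> \<le> measure ?P (space ?P - B)"
      using P.prob_compl[OF B] by simp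
    also have "\<dots> \<le> measure ?P G"
    proof (rule P.finite_measure_mono[OF _ G], rule subsetI)
      fix s assume s: "s \<in> space ?P - B"
      then have less: "\<Phi> s < (\<integral>s. \<Phi> s \<partial>?P) + \<epsilon>" by (auto simp: B_def)
      have "(\<integral>z. l t z \<partial>D) \<le> (\<Sum>i\<in>I. l t (s i)) / N
          + 2 * (card K)\<^sup>2 * c * C\<^sub>\<sigma> * C\<^sub>w / sqrt N + sqrt (ln (1 / \<delta>) / (2 * N))" if t: "t \<in> T" for t
      proof -
        have "N * (\<integral>z. l t z \<partial>D) - (\<Sum>i\<in>I. l t (s i)) = (\<Sum>i\<in>I. u t (s i))"
          by (simp add: u_def sum_subtractf N_def)
        also have "\<dots> \<le> 2 * (card K)\<^sup>2 * c * C\<^sub>\<sigma> * C\<^sub>w * sqrt N + \<epsilon>"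
          using \<Phi>_ge[OF t, of s] less E\<Phi> by linarith
        finally have "(\<integral>z. l t z \<partial>D) \<le>
            ((\<Sum>i\<in>I. l t (s i)) + 2 * (card K)\<^sup>2 * c * C\<^sub>\<sigma> * C\<^sub>w * sqrt N + \<epsilon>) / N"
          using N by (simp add: field_simps)
        also have "\<dots> = (\<Sum>i\<in>I. l t (s i)) / N + 2 * (card K)\<^sup>2 * c * C\<^sub>\<sigma> * C\<^sub>w * (sqrt N / N) + \<epsilon> / N"
          by (simp add: add_divide_distrib)
        also have "sqrt N / N = 1 / sqrt N"
          using N by (simp add: field_simps)
        also have "\<epsilon> / N = sqrt (ln (1 / \<delta>) / (2 * N))"
        proof -
          have "\<epsilon> / N = sqrt (N * ln (1 / \<delta>) / 2 / N\<^sup>2)"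
            unfolding \<epsilon>_def real_sqrt_divide[of _ "N\<^sup>2"] by (simp only: real_sqrt_abs abs_of_pos[OF N])
          also have "N * ln (1 / \<delta>) / 2 / N\<^sup>2 = ln (1 / \<delta>) / (2 * N)"
            using N by (simp add: field_simps power2_eq_square)
          finally show ?thesis .
        qed
        finally show ?thesis by simp
      qed
      then show "s \<in> G" using s by (simp add: G_def good_samples_def empirical_bound_def N_def)
    qed
    finally show ?thesis .
  qed
  then show ?thesis by (simp add: G_def)
qed

end

section \<open>From finite sets of models to the whole class\<close>

lemma countable_pointwise_dense:
  fixes g :: "'t \<Rightarrow> 'j \<Rightarrow> real"
  assumes J: "finite J"
  obtains U where "countable U" "U \<subseteq> F"
    "\<And>t. t \<in> F \<Longrightarrow> \<exists>\<tau>. range \<tau> \<subseteq> U \<and> (\<forall>j\<in>J. (\<lambda>n. g (\<tau> n) j) \<longlonglongrightarrow> g t j)"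
proof
  txt \<open>One representative for each attained rounding of the values to the grid of width \<open>1 / (n + 1)\<close>.\<close>
  define enc where "enc n t = (\<lambda>j\<in>J. \<lfloor>(real n + 1) * g t j\<rfloor>)" for n t
  \<comment> \<open>The representatives are members of \<open>F\<close> and not grid points, because
    bounds on the loss and the weights are available only inside the class.\<close>
  define U where "U = (\<Union>n. inv_into F (enc n) ` (enc n ` F))"
  have "countable (enc n ` F)" for n
  proof (rule countable_subset)
    show "enc n ` F \<subseteq> J \<rightarrow>\<^sub>E UNIV" by (auto simp: enc_def)
    show "countable (J \<rightarrow>\<^sub>E (UNIV :: int set))" using J by (intro countable_PiE) auto
  qed
  then show "countable U" unfolding U_def by (intro countable_UN countableI_type) (rule countable_image)
  show "U \<subseteq> F" unfolding U_def by (auto intro: inv_into_into)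
  fix t assume t: "t \<in> F"
  define \<tau> where "\<tau> n = inv_into F (enc n) (enc n t)" for n
  have "range \<tau> \<subseteq> U" unfolding U_def \<tau>_def using t by auto
  moreover have "(\<lambda>n. g (\<tau> n) j) \<longlonglongrightarrow> g t j" if j: "j \<in> J" for j
  proof -
    have bound: "norm (g (\<tau> n) j - g t j) \<le> inverse (real (Suc n))" for n
    proof -
      have "enc n (\<tau> n) = enc n t" unfolding \<tau>_def using t by (intro f_inv_into_f) auto
      then have "\<lfloor>(real n + 1) * g (\<tau> n) j\<rfloor> = \<lfloor>(real n + 1) * g t j\<rfloor>"
        using j by (auto simp: enc_def dest: fun_cong[of _ _ j])
      then have "\<bar>(real n + 1) * g (\<tau> n) j - (real n + 1) * g t j\<bar> \<le> 1" by linarith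
      then have "(real n + 1) * \<bar>g (\<tau> n) j - g t j\<bar> \<le> 1"
        by (simp add: abs_mult flip: right_diff_distrib)
      then show ?thesis by (simp add: field_simps)
    qed
    have "(\<lambda>n. g (\<tau> n) j - g t j) \<longlonglongrightarrow> 0"
      by (rule Lim_null_comparison[OF _ LIMSEQ_inverse_real_of_nat]) (use bound in auto)
    then show ?thesis by (simp add: LIM_zero_iff)
  qed
  ultimately show "\<exists>\<tau>. range \<tau> \<subseteq> U \<and> (\<forall>j\<in>J. (\<lambda>n. g (\<tau> n) j) \<longlonglongrightarrow> g t j)" by blast
qed

context Lipschitz_loss_class
begin

text \<open>The level \<open>1 - \<delta>\<close> for finite sets does not depend on their size.
  Along an exhaustion of \<open>T\<close> by finite sets the events decrease to the event for
  \<open>T\<close>, and continuity from above preserves the level.\<close>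

lemma measure_good_samples_countable:
  assumes T: "countable T" "T \<subseteq> \<F>" and I: "finite I" "I \<noteq> {}" and \<delta>: "0 < \<delta>" "\<delta> < 1"
  shows "good_samples I \<delta> T \<in> sets (Pi\<^sub>M I (\<lambda>_. D))"
    and "1 - \<delta> \<le> measure (Pi\<^sub>M I (\<lambda>_. D)) (good_samples I \<delta> T)"
proof -
  let ?P = "Pi\<^sub>M I (\<lambda>_. D)"
  interpret P: prob_space ?P by (intro prob_space_PiM prob_space_axioms)
  have "good_samples I \<delta> T \<in> sets ?P \<and> 1 - \<delta> \<le> measure ?P (good_samples I \<delta> T)"
  proof (cases "T = {}")
    case True
    then show ?thesis
      using good_samples_measurable[of T I \<delta>] measure_good_samples_finite[OF _ _ I \<delta>, of T] by auto
  next
    case False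
    define T' where "T' n = from_nat_into T ` {..n}" for n
    have T': "finite (T' n)" "T' n \<subseteq> \<F>" for n
      using from_nat_into[OF False] T by (auto simp: T'_def)
    have UN: "(\<Union>n. T' n) = T"
      unfolding T'_def image_UN[symmetric] UN_atMost_UNIV using False T(1) by (rule range_from_nat_into)
    have eq: "good_samples I \<delta> T = (\<Inter>n. good_samples I \<delta> (T' n))"
      unfolding UN[symmetric] good_samples_def by auto
    have meas: "range (\<lambda>n. good_samples I \<delta> (T' n)) \<subseteq> sets ?P"
      using good_samples_measurable[OF T'] by auto
    have "T' m \<subseteq> T' n" if "m \<le> n" for m n using that by (auto simp: T'_def)
    then have dec: "decseq (\<lambda>n. good_samples I \<delta> (T' n))"
      unfolding decseq_def good_samples_def by blast
    have "(\<lambda>n. measure ?P (good_samples I \<delta> (T' n))) \<longlonglongrightarrow> measure ?P (\<Inter>n. good_samples I \<delta> (T' n))"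
      by (rule P.finite_Lim_measure_decseq[OF meas dec])
    then have "1 - \<delta> \<le> measure ?P (good_samples I \<delta> T)"
      unfolding eq using measure_good_samples_finite[OF T' I \<delta>] by (intro LIMSEQ_le_const) auto
    moreover have "good_samples I \<delta> T \<in> sets ?P"
      unfolding eq using meas by (intro sets.countable_INT') auto
    ultimately show ?thesis by simp
  qed
  then show "good_samples I \<delta> T \<in> sets ?P" "1 - \<delta> \<le> measure ?P (good_samples I \<delta> T)" by auto
qed

text \<open>The measurable event is the one for a countable dense set. On it the inequality extends
  to the whole class, since both sides are continuous along pointwise convergent weights: the loss
  by its Lipschitz property, its mean by dominated convergence.\<close>

theorem generalization_bound:
  assumes I: "finite I" "I \<noteq> {}" and \<delta>: "0 < \<delta>" "\<delta> < 1"
  shows "holds_with_prob_at_least (Pi\<^sub>M I (\<lambda>_. D)) (1 - \<delta>)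
    (\<lambda>s. \<forall>t\<in>\<F>. (\<integral>z. l t z \<partial>D) \<le> empirical_bound I \<delta> s t)"
proof -
  obtain U where U: "countable U" "U \<subseteq> \<F>" and dense: "\<And>t. t \<in> \<F> \<Longrightarrow>
      \<exists>\<tau>. range \<tau> \<subseteq> U \<and> (\<forall>(k, p)\<in>K \<times> J. (\<lambda>n. w (\<tau> n) k p) \<longlonglongrightarrow> w t k p)"
    using countable_pointwise_dense[of "K \<times> J" \<F> "\<lambda>t (k, p). w t k p"] K J
    by (simp add: case_prod_unfold) blast
  have "(\<integral>z. l t z \<partial>D) \<le> empirical_bound I \<delta> s t" if s: "s \<in> good_samples I \<delta> U" and t: "t \<in> \<F>" for s t
  proof -
    obtain \<tau> where \<tau>: "range \<tau> \<subseteq> U"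
      and lim_w: "\<And>k p. k \<in> K \<Longrightarrow> p \<in> J \<Longrightarrow> (\<lambda>n. w (\<tau> n) k p) \<longlonglongrightarrow> w t k p"
      using dense[OF t] by auto
    have \<tau>\<F>: "\<tau> n \<in> \<F>" for n using \<tau> U by auto
    have lim_l: "(\<lambda>n. l (\<tau> n) z) \<longlonglongrightarrow> l t z" if z: "z \<in> space D" for z
    proof -
      have "(\<lambda>n. c * (\<Sum>k\<in>K. \<bar>(\<Sum>p\<in>J. \<phi> p z * w (\<tau> n) k p) - (\<Sum>p\<in>J. \<phi> p z * w t k p)\<bar>))
          \<longlonglongrightarrow> c * (\<Sum>k\<in>K. \<bar>(\<Sum>p\<in>J. \<phi> p z * w t k p) - (\<Sum>p\<in>J. \<phi> p z * w t k p)\<bar>)"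
        using lim_w by (intro tendsto_intros)
      then have "(\<lambda>n. c * (\<Sum>k\<in>K. \<bar>(\<Sum>p\<in>J. \<phi> p z * w (\<tau> n) k p) - (\<Sum>p\<in>J. \<phi> p z * w t k p)\<bar>)) \<longlonglongrightarrow> 0"
        by simp
      then have "(\<lambda>n. l (\<tau> n) z - l t z) \<longlonglongrightarrow> 0"
        by (rule Lim_null_comparison[rotated]) (use l_Lipschitz[OF \<tau>\<F> t z] in auto)
      then show ?thesis by (simp add: LIM_zero_iff)
    qed
    have "(\<lambda>n. \<integral>z. l (\<tau> n) z \<partial>D) \<longlonglongrightarrow> (\<integral>z. l t z \<partial>D)"
    proof (rule integral_dominated_convergence)
      show "integrable D (\<lambda>_. 1 :: real)" by simp
      show "AE z in D. norm (l (\<tau> n) z) \<le> 1" for n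
        using l_range[OF \<tau>\<F>] by (intro AE_I2) auto
    qed (use lim_l l_measurable t \<tau>\<F> in auto)
    moreover have "s i \<in> space D" if "i \<in> I" for i
      using s that by (auto simp: good_samples_def space_PiM)
    then have "(\<lambda>n. empirical_bound I \<delta> s (\<tau> n)) \<longlonglongrightarrow> empirical_bound I \<delta> s t"
      unfolding empirical_bound_def using I
      by (intro tendsto_add tendsto_divide tendsto_sum tendsto_const lim_l) auto
    moreover have "(\<integral>z. l (\<tau> n) z \<partial>D) \<le> empirical_bound I \<delta> s (\<tau> n)" for n
      using s \<tau> by (auto simp: good_samples_def)
    ultimately show ?thesis by (intro LIMSEQ_le) auto
  qed
  then show ?thesis
    unfolding holds_with_prob_at_least_def
    using measure_good_samples_countable[OF U I \<delta>] by blast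
qed

end

section \<open>The margin loss of path models\<close>

lemma ramp_range: "0 < \<rho> \<Longrightarrow> ramp \<rho> t \<in> {0..1}"
  by (auto simp: ramp_def)

lemma ramp_Lipschitz: "0 < \<rho> \<Longrightarrow> \<bar>ramp \<rho> s - ramp \<rho> t\<bar> \<le> \<bar>s - t\<bar> / \<rho>"
  by (auto simp: ramp_def field_simps abs_if)

text \<open>The output at \<open>y\<close> and the maximum over the competitors depend on disjoint
  sets of outputs, so their changes are covered by disjoint parts of the sum and the constant is
  1.\<close>

lemma margin_Lipschitz:
  assumes dy: "2 \<le> dy" and y: "y \<in> {1..dy}"
  shows "\<bar>margin dy z y - margin dy z' y\<bar> \<le> (\<Sum>k\<in>{1..dy}. \<bar>z k - z' k\<bar>)"
proof -
  let ?K = "{1..dy} - {y}"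
  \<comment> \<open>Two classes guarantee a competitor of \<open>y\<close>; without one the margin
    would contain \<open>Max {}\<close>.\<close>
  have ne: "?K \<noteq> {}"
  proof
    assume "?K = {}"
    then have "card {1..dy} \<le> card {y}" by (intro card_mono) auto
    then show False using dy by simp
  qed
  have Max_le: "Max (u ` ?K) \<le> Max (v ` ?K) + (\<Sum>k\<in>?K. \<bar>u k - v k\<bar>)" for u v :: vec
  proof (rule Max.boundedI)
    fix x assume "x \<in> u ` ?K"
    then obtain k where x: "x = u k" and k: "k \<in> ?K" by (rule imageE)
    have "u k - v k \<le> (\<Sum>k\<in>?K. \<bar>u k - v k\<bar>)"
      using member_le_sum[of k ?K "\<lambda>k. \<bar>u k - v k\<bar>"] k by auto
    moreover have "v k \<le> Max (v ` ?K)" using k by (intro Max_ge) auto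
    ultimately show "x \<le> Max (v ` ?K) + (\<Sum>k\<in>?K. \<bar>u k - v k\<bar>)" by (simp add: x)
  qed (use ne in auto)
  have "\<bar>Max (z ` ?K) - Max (z' ` ?K)\<bar> \<le> (\<Sum>k\<in>?K. \<bar>z k - z' k\<bar>)"
    using Max_le[of z z'] Max_le[of z' z] by (simp add: abs_le_iff abs_minus_commute)
  moreover have "(\<Sum>k\<in>{1..dy}. \<bar>z k - z' k\<bar>) = \<bar>z y - z' y\<bar> + (\<Sum>k\<in>?K. \<bar>z k - z' k\<bar>)"
    using y by (intro sum.remove) auto
  ultimately show ?thesis unfolding margin_def by linarith
qed

text \<open>A positive margin makes \<open>y\<close> the unique maximizer. Ties have margin at most
  0 and so already incur the full loss, whatever choice \<open>arg_max_on\<close> makes.\<close>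

lemma margin_loss_misclassified:
  assumes \<rho>: "0 < \<rho>" and y: "y \<in> {1..dy}" and wrong: "predicted_label dy z \<noteq> y"
  shows "margin_loss dy \<rho> z y = 1"
proof -
  have "margin dy z y \<le> 0"
  proof (rule ccontr)
    assume pos: "\<not> margin dy z y \<le> 0"
    have "z k < z y" if "k \<in> {1..dy}" "k \<noteq> y" for k
    proof -
      have "z k \<le> Max (z ` ({1..dy} - {y}))" using that by (intro Max_ge) auto
      then show ?thesis using pos by (simp add: margin_def)
    qed
    then have "is_arg_max z (\<lambda>k. k \<in> {1..dy}) k \<longleftrightarrow> k = y" for k
      using y by (fastforce simp: is_arg_max_def)
    then have "predicted_label dy z = y"
      by (simp add: predicted_label_def arg_max_on_def arg_max_def)
    with wrong show False by simp
  qed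
  then show ?thesis using \<rho> by (auto simp: margin_loss_def ramp_def)
qed

lemma margin_loss_range: "0 < \<rho> \<Longrightarrow> margin_loss dy \<rho> z y \<in> {0..1}"
  unfolding margin_loss_def by (rule ramp_range)

lemma margin_loss_Lipschitz:
  assumes "0 < \<rho>" "2 \<le> dy" "y \<in> {1..dy}"
  shows "\<bar>margin_loss dy \<rho> z y - margin_loss dy \<rho> z' y\<bar> \<le> (1 / \<rho>) * (\<Sum>k\<in>{1..dy}. \<bar>z k - z' k\<bar>)"
proof -
  have "\<bar>margin_loss dy \<rho> z y - margin_loss dy \<rho> z' y\<bar> \<le> \<bar>margin dy z y - margin dy z' y\<bar> / \<rho>"
    unfolding margin_loss_def by (rule ramp_Lipschitz) fact
  also have "\<dots> \<le> (\<Sum>k\<in>{1..dy}. \<bar>z k - z' k\<bar>) / \<rho>"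
    using assms by (intro divide_right_mono margin_Lipschitz) auto
  finally show ?thesis by simp
qed

text \<open>With countably many labels, measurability in the pair reduces to measurability in the
  input for each fixed label.\<close>

lemma measurable_example_split:
  assumes sets_D: "sets D = sets (N \<Otimes>\<^sub>M count_space A)" and A: "countable A"
    and F: "\<And>y. y \<in> A \<Longrightarrow> (\<lambda>x. F x y) \<in> N \<rightarrow>\<^sub>M L"
  shows "(\<lambda>(x, y). F x y) \<in> D \<rightarrow>\<^sub>M L"
proof -
  have "(\<lambda>(x, y). F x y) \<in> N \<Otimes>\<^sub>M count_space A \<rightarrow>\<^sub>M L"
    unfolding case_prod_unfold
  proof (rule measurable_compose_countable'[where g = snd and I = A])
    show "(\<lambda>p. F (fst p) y) \<in> N \<Otimes>\<^sub>M count_space A \<rightarrow>\<^sub>M L" if "y \<in> A" for y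
      using F[OF that] by measurable
  qed (use A in auto)
  then show ?thesis by (subst measurable_cong_sets[OF sets_D refl])
qed

lemma margin_loss_measurable:
  assumes z: "\<And>k. k \<in> {1..dy} \<Longrightarrow> (\<lambda>x. z x k) \<in> borel_measurable N" and y: "y \<in> {1..dy}"
  shows "(\<lambda>x. margin_loss dy \<rho> (z x) y) \<in> borel_measurable N"
proof -
  have ramp: "ramp \<rho> \<in> borel_measurable borel"
    unfolding ramp_def[abs_def] by measurable
  have "(\<lambda>x. margin dy (z x) y) \<in> borel_measurable N"
    unfolding margin_def using z y
    by (intro borel_measurable_diff borel_measurable_Max) auto
  then show ?thesis unfolding margin_loss_def by (rule measurable_compose) (rule ramp)
qed

lemma path_features_measurable:
  assumes mask: "\<And>l i. l \<in> {1..<L} \<Longrightarrow> i \<in> {1..n l} \<Longrightarrow> (\<lambda>x. d\<sigma> l x w i) \<in> borel_measurable (vec_space (n 0))"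
    and p: "p \<in> paths L n"
  shows "(\<lambda>x. path_features d\<sigma> w x p) \<in> borel_measurable (vec_space (n 0))"
proof -
  obtain i q where pq: "p = (0, i) # q"
    using p by (cases p) (auto simp: paths_def)
  have i: "i \<in> {1..n 0}" using p by (auto simp: pq paths_def)
  \<comment> \<open>Layers increase strictly along a path that starts in layer 0, so every later
    unit lies in a layer \<open>l \<ge> 1\<close>, where the masks are known to be
    measurable.\<close>
  have q: "l \<in> {1..<L} \<and> i \<in> {1..n l}" if "(l, i) \<in> set q" for l i
    using p that by (force simp: pq paths_def)
  have "(\<lambda>x. \<Prod>(l, i) \<leftarrow> q. d\<sigma> l x w i) \<in> borel_measurable (vec_space (n 0))"
    using q
  proof (induction q)
    case (Cons a q)
    have "(\<lambda>x. d\<sigma> (fst a) x w (snd a)) \<in> borel_measurable (vec_space (n 0))"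
      using Cons.prems[of "fst a" "snd a"] by (intro mask) auto
    moreover have "(\<lambda>x. \<Prod>(l, i) \<leftarrow> q. d\<sigma> l x w i) \<in> borel_measurable (vec_space (n 0))"
      using Cons by auto
    ultimately show ?case by (simp add: case_prod_unfold)
  qed simp
  moreover have "(\<lambda>x. x i) \<in> borel_measurable (vec_space (n 0))"
    using i by (rule measurable_component_singleton)
  ultimately show ?thesis
    unfolding path_features_def path_input_def path_mask_def pq by simp
qed

lemma risk_le_expected_margin_loss:
  assumes D: "prob_space D" "sets D = sets (example_space n0 dy)" and \<rho>: "0 < \<rho>"
    and meas: "(\<lambda>(x, y). margin_loss dy \<rho> (f x) y) \<in> borel_measurable D"
  shows "risk dy D f \<le> (\<integral>(x, y). margin_loss dy \<rho> (f x) y \<partial>D)"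
proof -
  interpret prob_space D by fact
  define A where "A = {(x, y) \<in> space D. predicted_label dy (f x) \<noteq> y}"
  define l where "l = (\<lambda>(x, y). margin_loss dy \<rho> (f x) y)"
  have range: "l z \<in> {0..1}" for z
    unfolding l_def using margin_loss_range[OF \<rho>] by (simp add: case_prod_unfold)
  have l: "l \<in> borel_measurable D" using meas by (simp add: l_def)
  have nonneg: "0 \<le> (\<integral>z. l z \<partial>D)" using range by (intro integral_nonneg_AE AE_I2) auto
  have "measure D A \<le> (\<integral>z. l z \<partial>D)"
  \<comment> \<open>Measurability of the misclassified set is not derived from that of the loss. If
    it fails, \<open>measure\<close> takes its default value 0 and nonnegativity of the loss
    suffices.\<close>
  proof (cases "A \<in> sets D")
    case True
    have "measure D A = (\<integral>z. indicator A z \<partial>D)" using True by simp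
    also have "\<dots> \<le> (\<integral>z. l z \<partial>D)"
    proof (rule integral_mono)
      show "integrable D (indicator A :: _ \<Rightarrow> real)"
        using True by (intro integrable_real_indicator) (auto simp: emeasure_eq_measure)
      show "integrable D l"
        by (rule integrable_const_bound[of _ 1, OF _ l]) (use range in auto)
      fix z assume "z \<in> space D"
      then have "snd z \<in> {1..dy}"
        unfolding sets_eq_imp_space_eq[OF D(2)] by (auto simp: space_pair_measure)
      then show "indicator A z \<le> l z"
        using range[of z] margin_loss_misclassified[OF \<rho>, of "snd z" dy "f (fst z)"]
        by (auto simp: indicator_def A_def l_def case_prod_unfold)
    qed
    finally show ?thesis .
  next
    case False
    then show ?thesis using nonneg by (simp add: measure_notin_sets)
  qed
  then show ?thesis by (simp add: risk_def A_def l_def)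
qed

text \<open>Freezing the masks makes the models linear in the path weights, so
  \<open>allowed\<close> indexes a \<open>Lipschitz_loss_class\<close> with constant 1/\<rho>.
  Independence and identical distribution identify the law of the second part of the sample with the
  product measure for which the general bound is stated.\<close>

theorem theorem9:
  fixes L dy m a :: nat and n :: "nat \<Rightarrow> nat"
    and W :: "'w weights" and \<sigma> :: "nat \<Rightarrow> nonlinearity" and d\<sigma> :: "'w masks" and w\<^sub>\<sigma> :: 'w
    and M :: "'o measure" and Z :: "nat \<Rightarrow> 'o \<Rightarrow> vec \<times> nat" and D :: "(vec \<times> nat) measure"
    and allowed :: "(nat \<Rightarrow> path \<Rightarrow> real) set"
    and \<alpha> \<rho> \<delta> m\<^sub>\<sigma> C\<^sub>\<sigma> C\<^sub>w :: real
  assumes net: "network L n W \<sigma> d\<sigma>"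
    and dy: "n L = dy" "2 \<le> dy"
    and mask_measurable: "\<And>l i. l \<in> {1..<L} \<Longrightarrow> i \<in> {1..n l} \<Longrightarrow>
          (\<lambda>x. d\<sigma> l x w\<^sub>\<sigma> i) \<in> borel_measurable (vec_space (n 0))"
    and alpha: "0 < \<alpha>" "\<alpha> < 1"
    and m: "0 < m" "real a = \<alpha> * real m"
    and m_sigma: "m\<^sub>\<sigma> = (1 - \<alpha>) * real m"
    and D: "prob_space D" "sets D = sets (example_space (n 0) dy)"
    and M: "prob_space M"
    and independent: "prob_space.indep_vars M (\<lambda>_. D) Z {a+1..m}"
    and identical: "\<And>i. i \<in> {a+1..m} \<Longrightarrow> distr M D (Z i) = D"
    and phases_independent: "prob_space.indep_var M
          (\<Pi>\<^sub>M i\<in>{1..a}. D) (subsample {1..a} Z) (\<Pi>\<^sub>M i\<in>{a+1..m}. D) (subsample {a+1..m} Z)"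
    and rho: "0 < \<rho>"
    and C_sigma: "0 \<le> C\<^sub>\<sigma>"
          "(\<integral>\<^sup>+ (x, y). ennreal ((L2_set (path_features d\<sigma> w\<^sub>\<sigma> x) (paths L n))\<^sup>2) \<partial>D) \<le> ennreal (C\<^sub>\<sigma>\<^sup>2)"
    and C_w: "\<And>wbar. wbar \<in> allowed \<Longrightarrow> (MAX k\<in>{1..dy}. L2_set (wbar k) (paths L n)) \<le> C\<^sub>w"
    and delta: "0 < \<delta>"
  shows "holds_with_prob_at_least
    (distr M (\<Pi>\<^sub>M i\<in>{a+1..m}. D) (subsample {a+1..m} Z)) (1 - \<delta>)
    (\<lambda>s. \<forall>f \<in> two_phase_models L n d\<sigma> w\<^sub>\<sigma> allowed.
       risk dy D f \<le> empirical_margin_loss dy \<rho> {a+1..m} s f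
         + 2 * (real dy)\<^sup>2 * (1 - \<alpha>) powr (- 1 / 2) * C\<^sub>\<sigma> * C\<^sub>w / (\<rho> * sqrt m\<^sub>\<sigma>)
         + sqrt (ln (1 / \<delta>) / (2 * m\<^sub>\<sigma>)))"
proof (cases "\<delta> < 1")
  case False
  \<comment> \<open>For \<delta> at least 1 the required probability is not positive, and the empty
    event serves as witness.\<close>
  then have "1 - \<delta> \<le> measure (distr M (\<Pi>\<^sub>M i\<in>{a+1..m}. D) (subsample {a+1..m} Z)) {}" by simp
  then show ?thesis unfolding holds_with_prob_at_least_def by blast
next
  case True
  interpret D: prob_space D by fact
  interpret M: prob_space M by fact
  define I where "I = {a+1..m}"
  have "real a < 1 * real m"
    unfolding m(2) using alpha m(1) by (intro mult_strict_right_mono) auto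
  then have "a < m" by simp
  then have I: "finite I" "I \<noteq> {}" and m_sigma_card: "m\<^sub>\<sigma> = real (card I)"
    using m(2) by (auto simp: I_def m_sigma algebra_simps)
  have m_sigma_pos: "0 < m\<^sub>\<sigma>" unfolding m_sigma_card using I by (simp add: card_gt_0_iff)
  have sample: "distr M (\<Pi>\<^sub>M i\<in>I. D) (subsample I Z) = (\<Pi>\<^sub>M i\<in>I. D)"
  proof -
    have rv: "Z i \<in> M \<rightarrow>\<^sub>M D" if "i \<in> I" for i
      using independent that by (auto simp: M.indep_vars_def I_def)
    have "distr M (\<Pi>\<^sub>M i\<in>I. D) (\<lambda>x. \<lambda>i\<in>I. Z i x) = (\<Pi>\<^sub>M i\<in>I. distr M D (Z i))"
      using M.indep_vars_iff_distr_eq_PiM'[OF I(2), of Z "\<lambda>_. D"] rv independent by (simp add: I_def)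
    also have "\<dots> = (\<Pi>\<^sub>M i\<in>I. D)"
      using identical by (intro PiM_cong) (auto simp: I_def)
    finally show ?thesis by (simp add: subsample_def[abs_def])
  qed
  define K where "K = {1..dy}"
  define J where "J = paths L n"
  define \<phi> where "\<phi> p = (\<lambda>(x, y :: nat). path_features d\<sigma> w\<^sub>\<sigma> x p)" for p
  define l where "l wbar = (\<lambda>(x, y). margin_loss dy \<rho> (path_model L n d\<sigma> w\<^sub>\<sigma> wbar x) y)" for wbar
  have output_eq: "path_model L n d\<sigma> w\<^sub>\<sigma> wbar x k = (\<Sum>p\<in>J. \<phi> p (x, y) * wbar k p)" for wbar x k y
    by (simp add: path_model_def \<phi>_def J_def)
  have features: "(\<lambda>x. path_features d\<sigma> w\<^sub>\<sigma> x p) \<in> borel_measurable (vec_space (n 0))" if "p \<in> J" for p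
    using mask_measurable that unfolding J_def by (rule path_features_measurable)
  have \<phi>_meas: "\<phi> p \<in> borel_measurable D" if "p \<in> J" for p
    unfolding \<phi>_def by (rule measurable_example_split[OF D(2)]) (use features[OF that] in auto)
  have l_meas: "l wbar \<in> borel_measurable D" for wbar
    unfolding l_def
  proof (rule measurable_example_split[OF D(2)])
    fix y assume "y \<in> {1..dy}"
    then show "(\<lambda>x. margin_loss dy \<rho> (path_model L n d\<sigma> w\<^sub>\<sigma> wbar x) y) \<in> borel_measurable (vec_space (n 0))"
      unfolding path_model_def using features
      by (intro margin_loss_measurable borel_measurable_sum borel_measurable_times borel_measurable_const)
        (auto simp: J_def)
  qed simp
  have J: "finite J" unfolding J_def by (rule finite_paths)
  have sq: "(L2_set (\<lambda>p. \<phi> p z) J)\<^sup>2 = (\<Sum>p\<in>J. (\<phi> p z)\<^sup>2)" for z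
    by (simp add: L2_set_def sum_nonneg)
  have "(\<integral>\<^sup>+ z. ennreal (\<Sum>p\<in>J. (\<phi> p z)\<^sup>2) \<partial>D) \<le> ennreal (C\<^sub>\<sigma>\<^sup>2)"
    using C_sigma(2) unfolding sq[symmetric] by (simp add: \<phi>_def J_def case_prod_unfold)
  \<comment> \<open>The moment bound is a nonnegative integral, so its finiteness also yields
    integrability. Each squared feature is dominated by the sum, and on a probability space square
    integrability gives integrability of the feature itself.\<close>
  then have sum_sq: "integrable D (\<lambda>z. \<Sum>p\<in>J. (\<phi> p z)\<^sup>2)" "(\<integral>z. (\<Sum>p\<in>J. (\<phi> p z)\<^sup>2) \<partial>D) \<le> C\<^sub>\<sigma>\<^sup>2"
    using \<phi>_meas
    by (auto intro!: integrableI_bounded integral_real_bounded borel_measurable_sum borel_measurable_power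
        simp: sum_nonneg order_le_less_trans[OF _ ennreal_less_top])
  have \<phi>_sq_int: "integrable D (\<lambda>z. (\<phi> p z)\<^sup>2)" if p: "p \<in> J" for p
  proof (rule Bochner_Integration.integrable_bound[OF sum_sq(1)])
    show "(\<lambda>z. (\<phi> p z)\<^sup>2) \<in> borel_measurable D" using \<phi>_meas[OF p] by simp
    show "AE z in D. norm ((\<phi> p z)\<^sup>2) \<le> norm (\<Sum>p\<in>J. (\<phi> p z)\<^sup>2)"
      using member_le_sum[OF p, of "\<lambda>p. (\<phi> p z)\<^sup>2" for z] J by (intro AE_I2) (simp add: sum_nonneg)
  qed
  have \<phi>_int: "integrable D (\<phi> p)" if "p \<in> J" for p
    using \<phi>_meas[OF that] \<phi>_sq_int[OF that] by (rule D.square_integrable_imp_integrable)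
  interpret Lipschitz_loss_class D allowed l K J \<phi> "\<lambda>wbar. wbar" "1 / \<rho>" C\<^sub>\<sigma> C\<^sub>w
  proof unfold_locales
    show "finite K" "K \<noteq> {}" using dy by (auto simp: K_def)
    show "finite J" by fact
    show "0 \<le> 1 / \<rho>" using rho by simp
    show "0 \<le> C\<^sub>\<sigma>" by fact
    show "integrable D (\<lambda>z. (\<phi> p z)\<^sup>2)" if "p \<in> J" for p using \<phi>_sq_int[OF that] .
    show "integrable D (\<phi> p)" if "p \<in> J" for p using \<phi>_int[OF that] .
    show "(\<Sum>p\<in>J. \<integral>z. (\<phi> p z)\<^sup>2 \<partial>D) \<le> C\<^sub>\<sigma>\<^sup>2"
      using sum_sq(2) \<phi>_sq_int by (simp add: Bochner_Integration.integral_sum)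
    show "L2_set (wbar k) J \<le> C\<^sub>w" if "wbar \<in> allowed" "k \<in> K" for wbar k
    proof -
      have "L2_set (wbar k) J \<le> (MAX k\<in>{1..dy}. L2_set (wbar k) (paths L n))"
        unfolding J_def using that(2) by (intro Max_ge) (auto simp: K_def)
      then show ?thesis using C_w[OF that(1)] by simp
    qed
    show "l wbar \<in> borel_measurable D" for wbar by (rule l_meas)
    show "l wbar z \<in> {0..1}" for wbar z
      unfolding l_def using margin_loss_range[OF rho] by (simp add: case_prod_unfold)
    fix wbar wbar' and z :: "vec \<times> nat" assume z: "z \<in> space D"
    obtain x y where xy: "z = (x, y)" by (cases z)
    then have y: "y \<in> {1..dy}"
      using z unfolding sets_eq_imp_space_eq[OF D(2)] by (auto simp: space_pair_measure)
    show "\<bar>l wbar z - l wbar' z\<bar> \<le>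
        1 / \<rho> * (\<Sum>k\<in>K. \<bar>(\<Sum>p\<in>J. \<phi> p z * wbar k p) - (\<Sum>p\<in>J. \<phi> p z * wbar' k p)\<bar>)"
      using margin_loss_Lipschitz[OF rho dy(2) y]
      unfolding xy output_eq[of _ _ _ y, symmetric] by (simp add: l_def K_def)
  qed
  have bound: "risk dy D f \<le> empirical_margin_loss dy \<rho> I s f
         + 2 * (real dy)\<^sup>2 * (1 - \<alpha>) powr (- 1 / 2) * C\<^sub>\<sigma> * C\<^sub>w / (\<rho> * sqrt m\<^sub>\<sigma>)
         + sqrt (ln (1 / \<delta>) / (2 * m\<^sub>\<sigma>))"
    if s: "\<forall>wbar\<in>allowed. (\<integral>z. l wbar z \<partial>D) \<le> empirical_bound I \<delta> s wbar"
      and f: "f \<in> two_phase_models L n d\<sigma> w\<^sub>\<sigma> allowed" for s f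
  proof -
    obtain wbar where wbar: "wbar \<in> allowed" and f_eq: "f = path_model L n d\<sigma> w\<^sub>\<sigma> wbar"
      using f by (auto simp: two_phase_models_def)
    have "0 \<le> L2_set (wbar 1) J" by simp
    also have "\<dots> \<le> C\<^sub>w" using norm_w[OF wbar, of 1] dy(2) by (simp add: K_def)
    finally have C\<^sub>w: "0 \<le> C\<^sub>w" .
    \<comment> \<open>The general bound produces the complexity term without this power of 1 -
      \<alpha>. The base lies in (0,1) and the exponent is negative, so the factor is at least 1 and
      inserting it can only enlarge the bound.\<close>
    have "(1 - \<alpha>) powr 0 \<le> (1 - \<alpha>) powr (- 1 / 2)"
      using alpha by (intro powr_mono') auto
    then have "1 \<le> (1 - \<alpha>) powr (- 1 / 2)" using alpha by simp
    then have "2 * (real dy)\<^sup>2 * C\<^sub>\<sigma> * C\<^sub>w / (\<rho> * sqrt m\<^sub>\<sigma>) * 1 \<le>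
        2 * (real dy)\<^sup>2 * C\<^sub>\<sigma> * C\<^sub>w / (\<rho> * sqrt m\<^sub>\<sigma>) * (1 - \<alpha>) powr (- 1 / 2)"
      using C_sigma(1) C\<^sub>w rho m_sigma_pos by (intro mult_left_mono) auto
    then have complexity: "2 * (real (card K))\<^sup>2 * (1 / \<rho>) * C\<^sub>\<sigma> * C\<^sub>w / sqrt m\<^sub>\<sigma> \<le>
        2 * (real dy)\<^sup>2 * (1 - \<alpha>) powr (- 1 / 2) * C\<^sub>\<sigma> * C\<^sub>w / (\<rho> * sqrt m\<^sub>\<sigma>)"
      by (simp add: K_def mult_ac)
    have "risk dy D f \<le> (\<integral>z. l wbar z \<partial>D)"
      using risk_le_expected_margin_loss[OF D rho, of f] l_meas[of wbar] by (simp add: l_def f_eq)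
    also have "\<dots> \<le> empirical_bound I \<delta> s wbar" using s wbar by simp
    also have "\<dots> = empirical_margin_loss dy \<rho> I s f
        + 2 * (real (card K))\<^sup>2 * (1 / \<rho>) * C\<^sub>\<sigma> * C\<^sub>w / sqrt m\<^sub>\<sigma> + sqrt (ln (1 / \<delta>) / (2 * m\<^sub>\<sigma>))"
      by (simp add: empirical_bound_def empirical_margin_loss_def l_def f_eq m_sigma_card case_prod_unfold)
    finally show ?thesis using complexity by linarith
  qed
  show ?thesis
    unfolding I_def[symmetric] sample
    using generalization_bound[OF I delta True] bound
    unfolding holds_with_prob_at_least_def by blast
qed

end
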